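(* Let $X$ be a complex Banach space, let $\mathcal{A}$ be a multivalued linear operator in $X$ satisfying condition (P) (stated in the context) with exponent $\beta\in(0,1]$, and let $(T(t))_{t>0}$ be the degenerate semigroup generated by $\mathcal{A}$. Suppose that $f\in APS^p(\mathbb{R}\times X:X)$ with $p\ge1$, that $L>0$, and that $$\|f(t,x)-f(t,y)\|\le L\|x-y\|,\quad t\in\mathbb{R},\ x,y\in X.$$ Suppose that $\beta=1$ provided $p=1$, and that $\frac p{p-1}<\frac1{1-\beta}$ provided $p>1$. Set $q':=\infty$ provided $p=1$, and $q':=\frac p{p-1}$ provided $p>1$. Assume that $M:=\sum_{k=0}^\infty\|T(\cdot)\|_{L^{q'}[k,k+1]}<\infty$ and $ML<1$. Then there exists a unique almost periodic mild solution of the inclusion $$u'(t)\in\mathcal{A}u(t)+f(t,u(t)),\quad t\in\mathbb{R}.$$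
   Context: A multivalued linear operator (MLO) in $X$ is a map $\mathcal{A}:X\to P(X)$ whose graph $\{(x,y):y\in\mathcal{A}x\}$ is a linear subspace of $X\times X$ (with $D(\mathcal{A})=\{x:\mathcal{A}x\ne\emptyset\}$). Its resolvent set $\rho(\mathcal{A})$ is the set of $\lambda\in\mathbb{C}$ such that $R(\lambda-\mathcal{A})=X$ (range) and $R(\lambda:\mathcal{A}):=(\lambda-\mathcal{A})^{-1}$ is a single-valued bounded operator on $X$. Condition (P): there exist finite constants $c,M_0>0$ and $\beta\in(0,1]$ such that $\Psi:=\{\lambda\in\mathbb{C}:\Re\lambda\ge-c(|\Im\lambda|+1)\}\subseteq\rho(\mathcal{A})$ and $\|R(\lambda:\mathcal{A})\|\le M_0(1+|\lambda|)^{-\beta}$ for $\lambda\in\Psi$. Under (P), $\mathcal{A}$ generates a degenerate strongly continuous semigroup $(T(t))_{t>0}\subseteq L(X)$, given by $T(t)=\frac1{2\pi i}\int_\Gamma e^{\lambda t}R(\lambda:\mathcal{A})\,d\lambda$, $t>0$, where $\Gamma$ is the curve $\lambda=-c(|\eta|+1)+i\eta$, $\eta$ running from $-\infty$ to $\infty$; it satisfies $\|T(t)\|=O(e^{-ct}t^{\beta-1})$, $t>0$. A mild solution of the inclusion is a continuous function $u:\mathbb{R}\to X$ such that $u(t)=\int_{-\infty}^tT(t-s)f(s,u(s))\,ds$ for all $t\in\mathbb{R}$. Convention: $1/(1-\beta)=+\infty$ if $\beta=1$. $\|T(\cdot)\|_{L^{q'}[k,k+1]}$ is the $L^{q'}$-norm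 of $t\mapsto\|T(t)\|$ on $[k,k+1]$. A continuous $u:\mathbb{R}\to X$ is almost periodic if for each $\epsilon>0$ there is $l>0$ such that every subinterval of $\mathbb{R}$ of length $l$ contains $\tau>0$ with $\|u(t+\tau)-u(t)\|\le\epsilon$ for all $t\in\mathbb{R}$. $APS^p(\mathbb{R}\times X:X)$ is the set of $f:\mathbb{R}\times X\to X$ such that $\hat f:\mathbb{R}\times X\to L^p([0,1]:X)$, $\hat f(t,x):=f(t+\cdot,x)$, is almost periodic, i.e. bounded, continuous, and such that for every $\epsilon>0$ and compact $K\subseteq X$ there is $l>0$ such that every subinterval of $\mathbb{R}$ of length $l$ contains $\tau$ with $\|\hat f(t+\tau,x)-\hat f(t,x)\|\le\epsilon$ for all $t\in\mathbb{R}$, $x\in K$.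
   Formalization: Almost periodicity is Bohr's: every interval of length l contains an almost period τ of any sign; the literal requirement τ>0 in every subinterval of ℝ fails on negative intervals, so no function (not even 0) would satisfy it. *)

theory Defs
  imports "HOL-Analysis.Analysis" "HOL-Probability.Essential_Supremum"
begin

section \<open>Complex Banach spaces\<close>

class scaleC =
  fixes scaleC :: "complex \<Rightarrow> 'a \<Rightarrow> 'a" (infixr \<open>*\<^sub>C\<close> 75)

class complex_normed_vector = real_normed_vector + scaleC +
  assumes scaleC_add_right: "a *\<^sub>C (x + y) = a *\<^sub>C x + a *\<^sub>C y"
    and scaleC_add_left: "(a + b) *\<^sub>C x = a *\<^sub>C x + b *\<^sub>C x"
    and scaleC_scaleC: "a *\<^sub>C (b *\<^sub>C x) = (a * b) *\<^sub>C x"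
    and scaleR_scaleC: "r *\<^sub>R x = complex_of_real r *\<^sub>C x"
    and norm_scaleC: "norm (a *\<^sub>C x) = cmod a * norm x"

class complex_banach = complex_normed_vector + banach

lemma scaleC_one: "1 *\<^sub>C x = (x :: 'a :: complex_normed_vector)"
  using scaleR_scaleC[of 1 x] by simp

lemma bounded_linear_scaleC: "bounded_linear (\<lambda>x :: 'a :: complex_normed_vector. a *\<^sub>C x)"
proof (rule bounded_linear_intro[where K = "cmod a"])
  show "a *\<^sub>C (r *\<^sub>R x) = r *\<^sub>R (a *\<^sub>C x)" for r and x :: 'a
    by (simp add: scaleR_scaleC scaleC_scaleC mult.commute)
qed (simp_all add: scaleC_add_right norm_scaleC mult.commute)

instantiation complex :: complex_banach
begin

definition scaleC_complex :: "complex \<Rightarrow> complex \<Rightarrow> complex"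
  where "scaleC_complex a x = a * x"

instance
  by standard (simp_all add: scaleC_complex_def algebra_simps norm_mult scaleR_conv_of_real)

end

text \<open>Operator spaces carry the pointwise complex structure, so that operator-valued integrals
  can be multiplied by complex numbers.\<close>

instantiation blinfun :: (real_normed_vector, complex_normed_vector) complex_normed_vector
begin

lift_definition scaleC_blinfun :: "complex \<Rightarrow> 'a \<Rightarrow>\<^sub>L 'b \<Rightarrow> 'a \<Rightarrow>\<^sub>L 'b"
  is "\<lambda>a f x. a *\<^sub>C f x"
  by (rule bounded_linear_compose[OF bounded_linear_scaleC])

instance
proof
  fix a b :: complex and r :: real and F G :: "'a \<Rightarrow>\<^sub>L 'b"
  show "a *\<^sub>C (F + G) = a *\<^sub>C F + a *\<^sub>C G"
    by transfer (simp add: scaleC_add_right)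
  show "(a + b) *\<^sub>C F = a *\<^sub>C F + b *\<^sub>C F"
    by transfer (simp add: scaleC_add_left)
  show "a *\<^sub>C (b *\<^sub>C F) = (a * b) *\<^sub>C F"
    by transfer (simp add: scaleC_scaleC)
  show "r *\<^sub>R F = complex_of_real r *\<^sub>C F"
    by transfer (simp add: scaleR_scaleC)
  have le: "norm (c *\<^sub>C H) \<le> cmod c * norm H" for c and H :: "'a \<Rightarrow>\<^sub>L 'b"
  proof (rule norm_blinfun_bound)
    show "norm (blinfun_apply (c *\<^sub>C H) x) \<le> cmod c * norm H * norm x" for x
      using mult_left_mono[OF norm_blinfun[of H x], of "cmod c"]
      by (simp add: scaleC_blinfun.rep_eq norm_scaleC mult.assoc)
  qed simp
  show "norm (a *\<^sub>C F) = cmod a * norm F"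
  proof (cases "a = 0")
    case True
    then show ?thesis using le[of a F] by simp
  next
    case False
    have "inverse a *\<^sub>C (a *\<^sub>C F) = F"
      using False by transfer (simp add: scaleC_scaleC scaleC_one)
    then have "norm F \<le> cmod (inverse a) * norm (a *\<^sub>C F)"
      using le[of "inverse a" "a *\<^sub>C F"] by simp
    then have "cmod a * norm F \<le> norm (a *\<^sub>C F)"
      using False by (simp add: norm_inverse norm_divide field_simps)
    then show ?thesis using le[of a F] by simp
  qed
qed

end

instance blinfun :: (real_normed_vector, complex_banach) complex_banach ..

definition bounded_clinear :: "('a :: complex_normed_vector \<Rightarrow> 'b :: complex_normed_vector) \<Rightarrow> bool"
  where "bounded_clinear F \<longleftrightarrow> bounded_linear F \<and> (\<forall>a x. F (a *\<^sub>C x) = a *\<^sub>C F x)"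


section \<open>Bochner integral\<close>

text \<open>The library's Bochner integral requires a second countable (separable) target space.  The
  following is the same definition with Borel measurability replaced by strong measurability,
  which makes it meaningful in arbitrary Banach spaces.\<close>

definition strongly_measurable :: "'a measure \<Rightarrow> ('a \<Rightarrow> 'b :: real_normed_vector) \<Rightarrow> bool"
  where "strongly_measurable N g \<longleftrightarrow>
    (\<exists>s :: nat \<Rightarrow> 'a \<Rightarrow> 'b. (\<forall>i. simple_function N (s i)) \<and> (AE x in N. (\<lambda>i. s i x) \<longlonglongrightarrow> g x))"

definition has_strong_integral :: "'a measure \<Rightarrow> ('a \<Rightarrow> 'b :: real_normed_vector) \<Rightarrow> 'b \<Rightarrow> bool"
  where "has_strong_integral N g I \<longleftrightarrow>
    strongly_measurable N g \<and>
    (\<exists>s :: nat \<Rightarrow> 'a \<Rightarrow> 'b. (\<forall>i. Bochner_Integration.simple_bochner_integrable N (s i)) \<and>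
      (\<lambda>i. \<integral>\<^sup>+x. ennreal (norm (g x - s i x)) \<partial>N) \<longlonglongrightarrow> 0 \<and>
      (\<lambda>i. Bochner_Integration.simple_bochner_integral N (s i)) \<longlonglongrightarrow> I)"

definition strong_integral :: "'a measure \<Rightarrow> ('a \<Rightarrow> 'b :: real_normed_vector) \<Rightarrow> 'b"
  where "strong_integral N g = (THE I. has_strong_integral N g I)"

lemma strongly_measurable_iff_borel_measurable:
  fixes g :: "'a \<Rightarrow> 'b :: {real_normed_vector, second_countable_topology}"
  assumes "complete_measure N"
  shows "strongly_measurable N g \<longleftrightarrow> g \<in> borel_measurable N"
proof
  assume "strongly_measurable N g"
  then obtain s where s: "\<And>i. simple_function N (s i)"
    and ae: "AE x in N. (\<lambda>i. s i x) \<longlonglongrightarrow> g x"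
    unfolding strongly_measurable_def by blast
  have sm: "s i \<in> borel_measurable N" for i
    by (rule borel_measurable_simple_function[OF s])
  obtain Z where Z: "Z \<in> null_sets N"
    and conv: "\<And>x. x \<in> space N - Z \<Longrightarrow> (\<lambda>i. s i x) \<longlonglongrightarrow> g x"
    using AE_E3[OF ae] by blast
  have Zs: "Z \<in> sets N" using Z by auto
  define h where "h x = (if x \<in> Z then 0 else g x)" for x
  have "h \<in> borel_measurable N"
  proof (rule borel_measurable_LIMSEQ_metric)
    show "(\<lambda>x. if x \<in> Z then 0 else s i x) \<in> borel_measurable N" for i
      using sm Zs by (intro measurable_If_set) auto
    show "(\<lambda>i. if x \<in> Z then 0 else s i x) \<longlonglongrightarrow> h x" if "x \<in> space N" for x
      using conv that by (auto simp: h_def)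
  qed
  moreover have "AE x in N. h x = g x"
    using AE_not_in[OF Z] by eventually_elim (simp add: h_def)
  ultimately show "g \<in> borel_measurable N"
  proof (intro measurableI)
    fix B :: "'b set"
    assume h: "h \<in> borel_measurable N" "AE x in N. h x = g x" and B: "B \<in> sets borel"
    show "g -` B \<inter> space N \<in> sets N"
    proof (rule complete_measure.in_sets_AE[OF assms])
      show "AE x in N. x \<in> h -` B \<inter> space N \<longleftrightarrow> x \<in> g -` B \<inter> space N"
        using h(2) by eventually_elim simp
      show "h -` B \<inter> space N \<in> sets N"
        using h(1) B by (rule measurable_sets)
    qed simp
  qed simp
next
  assume "g \<in> borel_measurable N"
  from borel_measurable_implies_sequence_metric[OF this, of 0]
  show "strongly_measurable N g"
    unfolding strongly_measurable_def by blast
qed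

lemma has_strong_integral_iff_has_bochner_integral:
  fixes g :: "'a \<Rightarrow> 'b :: {real_normed_vector, second_countable_topology}"
  assumes "complete_measure N"
  shows "has_strong_integral N g I \<longleftrightarrow> has_bochner_integral N g I"
  unfolding has_strong_integral_def strongly_measurable_iff_borel_measurable[OF assms]
    has_bochner_integral.simps by blast


section \<open>Lebesgue norms\<close>

text \<open>The root of the \<open>q\<close>-th moment is taken in the reals after the infinite case has been split
  off.  Measurability is not part of this definition.\<close>

definition Lq_norm :: "ereal \<Rightarrow> 'a measure \<Rightarrow> ('a \<Rightarrow> 'b :: real_normed_vector) \<Rightarrow> ennreal"
  where "Lq_norm q N g =
    (if q = \<infinity> then esssup N (\<lambda>x. ennreal (norm (g x)))
     else let I = (\<integral>\<^sup>+x. ennreal (norm (g x) powr real_of_ereal q) \<partial>N)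
          in if I = \<infinity> then \<infinity> else ennreal (enn2real I powr (1 / real_of_ereal q)))"

definition Lp_space :: "real \<Rightarrow> 'a measure \<Rightarrow> ('a \<Rightarrow> 'b :: real_normed_vector) set"
  where "Lp_space p N = {g. strongly_measurable N g \<and> Lq_norm (ereal p) N g < \<infinity>}"


section \<open>Multivalued linear operators\<close>

definition MLO :: "('a :: complex_normed_vector \<Rightarrow> 'a set) \<Rightarrow> bool"
  where "MLO \<A> \<longleftrightarrow>
    0 \<in> \<A> 0 \<and>
    (\<forall>x x' y y'. y \<in> \<A> x \<longrightarrow> y' \<in> \<A> x' \<longrightarrow> y + y' \<in> \<A> (x + x')) \<and>
    (\<forall>a x y. y \<in> \<A> x \<longrightarrow> a *\<^sub>C y \<in> \<A> (a *\<^sub>C x))"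

definition mlo_range :: "('a \<Rightarrow> 'a set) \<Rightarrow> 'a set"
  where "mlo_range \<A> = (\<Union>x. \<A> x)"

definition mlo_inverse :: "('a \<Rightarrow> 'a set) \<Rightarrow> 'a \<Rightarrow> 'a set"
  where "mlo_inverse \<A> y = {x. y \<in> \<A> x}"

definition scalar_minus :: "complex \<Rightarrow> ('a :: complex_normed_vector \<Rightarrow> 'a set) \<Rightarrow> 'a \<Rightarrow> 'a set"
  where "scalar_minus z \<A> x = (\<lambda>y. z *\<^sub>C x - y) ` \<A> x"

definition resolvent_set :: "('a :: complex_normed_vector \<Rightarrow> 'a set) \<Rightarrow> complex set"
  where "resolvent_set \<A> =
    {z. mlo_range (scalar_minus z \<A>) = UNIV \<and>
        (\<exists>R. bounded_clinear R \<and> (\<forall>x. mlo_inverse (scalar_minus z \<A>) x = {R x}))}"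

definition resolvent :: "('a :: complex_normed_vector \<Rightarrow> 'a set) \<Rightarrow> complex \<Rightarrow> 'a \<Rightarrow>\<^sub>L 'a"
  where "resolvent \<A> z =
    (THE R. \<forall>x. mlo_inverse (scalar_minus z \<A>) x = {blinfun_apply R x})"

definition condition_P ::
    "('a :: complex_normed_vector \<Rightarrow> 'a set) \<Rightarrow> real \<Rightarrow> real \<Rightarrow> real \<Rightarrow> bool"
  where "condition_P \<A> c M\<^sub>0 \<beta> \<longleftrightarrow>
    0 < c \<and> 0 < M\<^sub>0 \<and> 0 < \<beta> \<and> \<beta> \<le> 1 \<and>
    {z. Re z \<ge> - c * (\<bar>Im z\<bar> + 1)} \<subseteq> resolvent_set \<A> \<and>
    (\<forall>z. Re z \<ge> - c * (\<bar>Im z\<bar> + 1) \<longrightarrow>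
      norm (resolvent \<A> z) \<le> M\<^sub>0 * (1 + cmod z) powr (- \<beta>))"

definition \<Gamma>_curve :: "real \<Rightarrow> real \<Rightarrow> complex"
  where "\<Gamma>_curve c \<eta> = Complex (- c * (\<bar>\<eta>\<bar> + 1)) \<eta>"

text \<open>The curve is parametrised by \<open>\<eta>\<close>, and \<open>Complex (- c * sgn \<eta>) 1\<close> is its derivative for
  \<open>\<eta> \<noteq> 0\<close>.  Only the values at \<open>t > 0\<close> are meaningful.\<close>

definition degenerate_semigroup ::
    "('a :: complex_banach \<Rightarrow> 'a set) \<Rightarrow> real \<Rightarrow> real \<Rightarrow> 'a \<Rightarrow>\<^sub>L 'a"
  where "degenerate_semigroup \<A> c t =
    (1 / (2 * complex_of_real pi * \<i>)) *\<^sub>C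
      strong_integral lebesgue (\<lambda>\<eta>.
        (exp (\<Gamma>_curve c \<eta> * complex_of_real t) * Complex (- c * sgn \<eta>) 1) *\<^sub>C
          resolvent \<A> (\<Gamma>_curve c \<eta>))"


section \<open>Almost periodicity and mild solutions\<close>

definition almost_periodic :: "(real \<Rightarrow> 'a :: real_normed_vector) \<Rightarrow> bool"
  where "almost_periodic u \<longleftrightarrow>
    continuous_on UNIV u \<and>
    (\<forall>\<epsilon>>0. \<exists>l>0. \<forall>a. \<exists>\<tau>\<in>{a..a + l}. \<forall>t. norm (u (t + \<tau>) - u t) \<le> \<epsilon>)"

text \<open>Equivalently, only positive almost periods and intervals in the half-line are considered.\<close>

lemma almost_periodic_iff_positive:
  "almost_periodic u \<longleftrightarrow>
    continuous_on UNIV u \<and>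
    (\<forall>\<epsilon>>0. \<exists>l>0. \<forall>a\<ge>0. \<exists>\<tau>\<in>{a..a + l}. \<tau> > 0 \<and> (\<forall>t. norm (u (t + \<tau>) - u t) \<le> \<epsilon>))"
proof -
  let ?P = "\<lambda>\<epsilon> \<tau>. \<forall>t. norm (u (t + \<tau>) - u t) \<le> \<epsilon>"
  have eq: "(\<exists>l>0. \<forall>a. \<exists>\<tau>\<in>{a..a + l}. ?P \<epsilon> \<tau>) \<longleftrightarrow>
      (\<exists>l>0. \<forall>a\<ge>0. \<exists>\<tau>\<in>{a..a + l}. \<tau> > 0 \<and> ?P \<epsilon> \<tau>)" if "\<epsilon> > 0" for \<epsilon> :: real
  proof
    assume "\<exists>l>0. \<forall>a. \<exists>\<tau>\<in>{a..a + l}. ?P \<epsilon> \<tau>"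
    then obtain l where l: "l > 0" "\<And>a. \<exists>\<tau>\<in>{a..a + l}. ?P \<epsilon> \<tau>" by blast
    have "\<exists>\<tau>\<in>{a..a + (l + 1)}. \<tau> > 0 \<and> ?P \<epsilon> \<tau>" if "a \<ge> 0" for a
    proof -
      obtain \<tau> where "\<tau> \<in> {a + 1..a + 1 + l}" "?P \<epsilon> \<tau>" using l(2) by blast
      then show ?thesis using that by (intro bexI[of _ \<tau>]) auto
    qed
    then show "\<exists>l>0. \<forall>a\<ge>0. \<exists>\<tau>\<in>{a..a + l}. \<tau> > 0 \<and> ?P \<epsilon> \<tau>"
      using l(1) by (intro exI[of _ "l + 1"]) auto
  next
    assume "\<exists>l>0. \<forall>a\<ge>0. \<exists>\<tau>\<in>{a..a + l}. \<tau> > 0 \<and> ?P \<epsilon> \<tau>"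
    then obtain l where l: "l > 0" "\<And>a. a \<ge> 0 \<Longrightarrow> \<exists>\<tau>\<in>{a..a + l}. \<tau> > 0 \<and> ?P \<epsilon> \<tau>" by blast
    have "\<exists>\<tau>\<in>{a..a + l}. ?P \<epsilon> \<tau>" for a
    proof (cases "a \<ge> 0")
      case True
      then show ?thesis using l(2) by blast
    next
      case False
      show ?thesis
      proof (cases "a + l \<ge> 0")
        case True
        then show ?thesis using False that by (intro bexI[of _ 0]) auto
      next
        case neg: False
        then obtain \<tau> where \<tau>: "\<tau> \<in> {- a - l..- a - l + l}" "?P \<epsilon> \<tau>"
          using l(2)[of "- a - l"] by auto
        have "?P \<epsilon> (- \<tau>)"
        proof
          fix t
          show "norm (u (t + - \<tau>) - u t) \<le> \<epsilon>"
            using \<tau>(2)[rule_format, of "t - \<tau>"] by (simp add: norm_minus_commute)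
        qed
        then show ?thesis using \<tau>(1) by (intro bexI[of _ "- \<tau>"]) auto
      qed
    qed
    then show "\<exists>l>0. \<forall>a. \<exists>\<tau>\<in>{a..a + l}. ?P \<epsilon> \<tau>" using l(1) by blast
  qed
  show ?thesis
    unfolding almost_periodic_def by (intro conj_cong refl all_cong1 imp_cong eq)
qed

text \<open>The map \<open>f_hat f\<close> takes values in (representatives of elements of) the space of
  \<open>p\<close>-integrable functions on \<open>[0, 1]\<close>.\<close>

definition f_hat :: "(real \<Rightarrow> 'a \<Rightarrow> 'b) \<Rightarrow> real \<times> 'a \<Rightarrow> real \<Rightarrow> 'b"
  where "f_hat f = (\<lambda>(t, x) s. f (t + s) x)"

abbreviation Stepanov_norm :: "real \<Rightarrow> (real \<Rightarrow> 'b :: real_normed_vector) \<Rightarrow> ennreal"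
  where "Stepanov_norm p \<equiv> Lq_norm (ereal p) (lebesgue_on {0..1})"

definition APS :: "real \<Rightarrow> (real \<Rightarrow> 'a :: real_normed_vector \<Rightarrow> 'b :: real_normed_vector) set"
  where "APS p = {f.
    (\<forall>z. f_hat f z \<in> Lp_space p (lebesgue_on {0..1})) \<and>
    (\<exists>B :: real. \<forall>z. Stepanov_norm p (f_hat f z) \<le> ennreal B) \<and>
    (\<forall>z. ((\<lambda>w. Stepanov_norm p (\<lambda>s. f_hat f w s - f_hat f z s)) \<longlongrightarrow> 0) (at z)) \<and>
    (\<forall>\<epsilon>>0. \<forall>K. compact K \<longrightarrow>
      (\<exists>l>0. \<forall>a. \<exists>\<tau>\<in>{a..a + l}. \<forall>t. \<forall>x\<in>K.
        Stepanov_norm p (\<lambda>s. f_hat f (t + \<tau>, x) s - f_hat f (t, x) s) \<le> ennreal \<epsilon>))}"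

definition mild_solution ::
    "(real \<Rightarrow> 'a :: real_normed_vector \<Rightarrow>\<^sub>L 'a) \<Rightarrow> (real \<Rightarrow> 'a \<Rightarrow> 'a) \<Rightarrow> (real \<Rightarrow> 'a) \<Rightarrow> bool"
  where "mild_solution T f u \<longleftrightarrow>
    continuous_on UNIV u \<and>
    (\<forall>t. has_strong_integral (lebesgue_on {..<t})
           (\<lambda>s. blinfun_apply (T (t - s)) (f s (u s))) (u t))"

end

theory Submission
  imports Defs
begin

text \<open>The substitution \<open>r = t - s\<close> turns the right-hand side of the mild solution equation into
  \<open>\<integral> T(r) f(t - r, u(t - r)) dr\<close> over \<open>r > 0\<close>.  Hoelder's inequality on each \<open>[k, k + 1]\<close> bounds the
  norm of such an integral by \<open>M\<close> times the Stepanov norm of the function convolved with \<open>T\<close>.  If \<open>u\<close> is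
  almost periodic, its range is totally bounded, so by the Lipschitz condition the oscillation of
  \<open>f(s, u(s))\<close> under a translation is controlled by that of \<open>u\<close> and of finitely many \<open>f(s, x)\<close>.  Hence the
  right-hand side is again almost periodic in \<open>t\<close>, and it depends on \<open>u\<close> with Lipschitz constant
  \<open>M L < 1\<close>: Banach's fixed point theorem applies to the closed set of almost periodic functions
  among the bounded continuous ones.  The measurability of \<open>T\<close> rests on its norm continuity on
  \<open>t > 0\<close>, which dominated convergence in the contour integral gives.\<close>

section \<open>Strong measurability\<close>

lemma strongly_measurable_borelE:
  fixes g :: "'a \<Rightarrow> 'b::real_normed_vector"
  assumes "strongly_measurable N g"
  obtains h D where "h \<in> borel_measurable N" "countable D" "0 \<in> D"
    "\<And>x. x \<in> space N \<Longrightarrow> h x \<in> closure D" "AE x in N. g x = h x"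
proof -
  obtain s where s: "\<And>i. simple_function N (s i)"
    and ae: "AE x in N. (\<lambda>i. s i x) \<longlonglongrightarrow> g x"
    using assms unfolding strongly_measurable_def by blast
  obtain Z where Z: "Z \<in> null_sets N"
    and conv: "\<And>x. x \<in> space N - Z \<Longrightarrow> (\<lambda>i. s i x) \<longlonglongrightarrow> g x"
    using AE_E3[OF ae] by blast
  define h where "h x = (if x \<in> Z then 0 else g x)" for x
  define D where "D = insert 0 (\<Union>i. s i ` space N)"
  show ?thesis
  proof
    show "h \<in> borel_measurable N"
    proof (rule borel_measurable_LIMSEQ_metric)
      show "(\<lambda>x. if x \<in> Z then 0 else s i x) \<in> borel_measurable N" for i
        using borel_measurable_simple_function[OF s] Z by (intro measurable_If_set) auto
      show "(\<lambda>i. if x \<in> Z then 0 else s i x) \<longlonglongrightarrow> h x" if "x \<in> space N" for x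
        using conv that by (auto simp: h_def)
    qed
    show "countable D"
      using simple_functionD(1)[OF s] by (auto simp: D_def countable_finite)
    show "0 \<in> D" by (simp add: D_def)
    show "h x \<in> closure D" if "x \<in> space N" for x
    proof (cases "x \<in> Z")
      case True
      then show ?thesis
        using closure_subset[of D] by (auto simp: h_def D_def)
    next
      case False
      then have "(\<lambda>i. s i x) \<longlonglongrightarrow> h x" using conv that by (simp add: h_def)
      moreover have "\<And>i. s i x \<in> D" using that by (auto simp: D_def)
      ultimately show ?thesis
        unfolding closure_sequential by (intro exI[of _ "\<lambda>i. s i x"]) simp
    qed
    show "AE x in N. g x = h x"
      using AE_not_in[OF Z] by eventually_elim (simp add: h_def)
  qed
qed

text \<open>Since \<open>z\<close> is among the candidates from the start, a nearest-point approximation is never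
  farther from \<open>h\<close> than \<open>z\<close> is.  For \<open>z = 0\<close> this provides an integrable bound.\<close>

lemma separable_borel_approx:
  fixes h :: "'a \<Rightarrow> 'b::metric_space"
  assumes h: "h \<in> borel_measurable N" and D: "countable D" "z \<in> D"
    and cl: "\<And>x. x \<in> space N \<Longrightarrow> h x \<in> closure D"
  obtains s where "\<And>i::nat. simple_function N (s i)"
    "\<And>x. x \<in> space N \<Longrightarrow> (\<lambda>i. s i x) \<longlonglongrightarrow> h x"
    "\<And>i x. dist (s i x) (h x) \<le> dist z (h x)"
proof -
  define e where "e n = (case n of 0 \<Rightarrow> z | Suc m \<Rightarrow> from_nat_into D m)" for n
  define s where "s = rec_nat (\<lambda>x. z)
    (\<lambda>n r x. if dist (h x) (e (Suc n)) < dist (h x) (r x) then e (Suc n) else r x)"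
  have s0: "s 0 = (\<lambda>x. z)" by (simp add: s_def)
  have sS: "s (Suc n) = (\<lambda>x. if dist (h x) (e (Suc n)) < dist (h x) (s n x) then e (Suc n) else s n x)" for n
    unfolding s_def by simp
  have hd: "(\<lambda>x. dist (h x) d) \<in> borel_measurable N" for d
    by (rule measurable_compose[OF h]) (intro borel_measurable_continuous_onI continuous_intros)
  have "simple_function N (s n) \<and> (\<lambda>x. dist (h x) (s n x)) \<in> borel_measurable N" for n
  proof (induction n)
    case 0
    then show ?case using hd by (simp add: s0)
  next
    case (Suc n)
    have m: "{x \<in> space N. dist (h x) (e (Suc n)) < dist (h x) (s n x)} \<in> sets N"
      using Suc hd by (intro borel_measurable_less) auto
    have eq: "(\<lambda>x. dist (h x) (s (Suc n) x)) =
        (\<lambda>x. min (dist (h x) (e (Suc n))) (dist (h x) (s n x)))"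
      by (auto simp: sS min_def)
    show ?case
      using Suc m hd unfolding eq
      by (auto simp: sS intro!: simple_function_If borel_measurable_min)
  qed
  then have simple: "simple_function N (s n)" for n by blast
  have le: "dist (h x) (s n x) \<le> dist (h x) (e i)" if "i \<le> n" for n i x
    using that
  proof (induction n)
    case 0
    then show ?case by (simp add: s0 e_def)
  next
    case (Suc n)
    then show ?case by (cases "i = Suc n") (auto simp: sS)
  qed
  show ?thesis
  proof
    show "simple_function N (s i)" for i by (rule simple)
    show "dist (s i x) (h x) \<le> dist z (h x)" for i x
      using le[of 0 i x] by (simp add: e_def dist_commute)
    show "(\<lambda>i. s i x) \<longlonglongrightarrow> h x" if x: "x \<in> space N" for x
    proof (rule metric_LIMSEQ_I)
      fix r :: real assume "0 < r"
      then obtain d where d: "d \<in> D" "dist d (h x) < r"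
        using cl[OF x] by (auto simp: closure_approachable)
      obtain m where "d = from_nat_into D m"
        using from_nat_into_surj[OF D(1) d(1)] by auto
      then have "d = e (Suc m)" by (simp add: e_def)
      then have "dist (s n x) (h x) < r" if "n \<ge> Suc m" for n
        using le[OF that, of x] d(2) by (simp add: dist_commute)
      then show "\<exists>no. \<forall>n\<ge>no. dist (s n x) (h x) < r" by blast
    qed
  qed
qed

lemma strongly_measurableI_borel:
  fixes g :: "'a \<Rightarrow> 'b::real_normed_vector"
  assumes "h \<in> borel_measurable N" "countable D" "d \<in> D"
    "\<And>x. x \<in> space N \<Longrightarrow> h x \<in> closure D" "AE x in N. g x = h x"
  shows "strongly_measurable N g"
proof -
  obtain s where s: "\<And>i::nat. simple_function N (s i)"
    "\<And>x. x \<in> space N \<Longrightarrow> (\<lambda>i. s i x) \<longlonglongrightarrow> h x"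
    using separable_borel_approx[OF assms(1-4)] by metis
  have "AE x in N. (\<lambda>i. s i x) \<longlonglongrightarrow> g x"
    using assms(5) AE_space by eventually_elim (use s(2) in simp)
  then show ?thesis using s(1) unfolding strongly_measurable_def by blast
qed

lemma strongly_measurable_simple_function:
  "simple_function N g \<Longrightarrow> strongly_measurable N g"
  unfolding strongly_measurable_def by (intro exI[of _ "\<lambda>_. g"]) simp

lemma strongly_measurable_LIMSEQ:
  fixes g :: "nat \<Rightarrow> 'a \<Rightarrow> 'b::real_normed_vector"
  assumes sm: "\<And>n. strongly_measurable N (g n)"
    and lim: "AE x in N. (\<lambda>n. g n x) \<longlonglongrightarrow> G x"
  shows "strongly_measurable N G"
proof -
  have "\<exists>h D. h \<in> borel_measurable N \<and> countable D \<and> 0 \<in> D \<and>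
    (\<forall>x\<in>space N. h x \<in> closure D) \<and> (AE x in N. g n x = h x)" for n
    using strongly_measurable_borelE[OF sm[of n]] by metis
  then obtain h D where h: "\<And>n. h n \<in> borel_measurable N"
    and D: "\<And>n. countable (D n)" "\<And>n. 0 \<in> D n" "\<And>n x. x \<in> space N \<Longrightarrow> h n x \<in> closure (D n)"
    and ae: "\<And>n. AE x in N. g n x = h n x"
    by metis
  have "AE x in N. \<forall>n. g n x = h n x"
    using ae by (simp add: AE_all_countable)
  then have "AE x in N. (\<lambda>n. h n x) \<longlonglongrightarrow> G x"
    using lim by eventually_elim simp
  from AE_E3[OF this] obtain Z where Z: "Z \<in> null_sets N"
    and conv: "\<And>x. x \<in> space N - Z \<Longrightarrow> (\<lambda>n. h n x) \<longlonglongrightarrow> G x"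
    by blast
  define H where "H x = (if x \<in> Z then 0 else G x)" for x
  show ?thesis
  proof (rule strongly_measurableI_borel)
    show "H \<in> borel_measurable N"
    proof (rule borel_measurable_LIMSEQ_metric)
      show "(\<lambda>x. if x \<in> Z then 0 else h i x) \<in> borel_measurable N" for i
        using h Z by (intro measurable_If_set) auto
      show "(\<lambda>i. if x \<in> Z then 0 else h i x) \<longlonglongrightarrow> H x" if "x \<in> space N" for x
        using conv that by (auto simp: H_def)
    qed
    show "countable (\<Union>n. D n)" using D(1) by auto
    show "0 \<in> (\<Union>n. D n)" using D(2) by auto
    show "H x \<in> closure (\<Union>n. D n)" if x: "x \<in> space N" for x
    proof (cases "x \<in> Z")
      case True
      then show ?thesis
        using closure_subset[of "\<Union>n. D n"] D(2) by (auto simp: H_def)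
    next
      case False
      have "h n x \<in> closure (\<Union>n. D n)" for n
        using D(3)[OF x, of n] closure_mono[of "D n" "\<Union>n. D n"] by blast
      moreover have "(\<lambda>n. h n x) \<longlonglongrightarrow> H x"
        using conv x False by (simp add: H_def)
      ultimately show ?thesis
        by (rule closed_sequentially[OF closed_closure])
    qed
    show "AE x in N. G x = H x"
      using AE_not_in[OF Z] by eventually_elim (simp add: H_def)
  qed
qed

lemma strongly_measurable_compose2:
  fixes p :: "'b::real_normed_vector \<Rightarrow> 'c::real_normed_vector \<Rightarrow> 'd::real_normed_vector"
  assumes g: "strongly_measurable N g" and h: "strongly_measurable N h"
    and p: "\<And>X Y x y. X \<longlonglongrightarrow> x \<Longrightarrow> Y \<longlonglongrightarrow> y \<Longrightarrow> (\<lambda>n. p (X n) (Y n)) \<longlonglongrightarrow> p x y"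
  shows "strongly_measurable N (\<lambda>x. p (g x) (h x))"
proof -
  obtain s where s: "\<And>i. simple_function N (s i)" "AE x in N. (\<lambda>i. s i x) \<longlonglongrightarrow> g x"
    using g unfolding strongly_measurable_def by blast
  obtain t where t: "\<And>i. simple_function N (t i)" "AE x in N. (\<lambda>i. t i x) \<longlonglongrightarrow> h x"
    using h unfolding strongly_measurable_def by blast
  have "AE x in N. (\<lambda>i. p (s i x) (t i x)) \<longlonglongrightarrow> p (g x) (h x)"
    using s(2) t(2) by eventually_elim (rule p)
  moreover have "simple_function N (\<lambda>x. p (s i x) (t i x))" for i
    by (rule simple_function_compose2[OF s(1) t(1)])
  ultimately show ?thesis
    unfolding strongly_measurable_def by (intro exI[of _ "\<lambda>i x. p (s i x) (t i x)"]) blast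
qed

lemma strongly_measurable_const: "strongly_measurable N (\<lambda>_. c)"
  by (rule strongly_measurable_simple_function) simp

lemma strongly_measurable_add:
  "strongly_measurable N g \<Longrightarrow> strongly_measurable N h \<Longrightarrow> strongly_measurable N (\<lambda>x. g x + h x)"
  by (rule strongly_measurable_compose2) (auto intro: tendsto_add)

lemma strongly_measurable_diff:
  "strongly_measurable N g \<Longrightarrow> strongly_measurable N h \<Longrightarrow> strongly_measurable N (\<lambda>x. g x - h x)"
  by (rule strongly_measurable_compose2) (auto intro: tendsto_diff)

lemma strongly_measurable_sum:
  "(\<And>i. i \<in> I \<Longrightarrow> strongly_measurable N (g i)) \<Longrightarrow> strongly_measurable N (\<lambda>x. \<Sum>i\<in>I. g i x)"
  by (induction I rule: infinite_finite_induct)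
    (auto intro: strongly_measurable_add strongly_measurable_const)

lemma strongly_measurable_norm:
  assumes "strongly_measurable N g"
  shows "strongly_measurable N (\<lambda>x. norm (g x))"
  by (rule strongly_measurable_compose2[OF assms assms, of "\<lambda>x y. norm x"]) (auto intro: tendsto_norm)

lemma borel_measurable_norm_strongly_measurable:
  assumes "complete_measure N" "strongly_measurable N g"
  shows "(\<lambda>x. norm (g x)) \<in> borel_measurable N"
  using strongly_measurable_norm[OF assms(2)] strongly_measurable_iff_borel_measurable[OF assms(1)]
  by blast

lemma strongly_measurable_cong_AE:
  assumes "strongly_measurable N g" "AE x in N. g x = h x"
  shows "strongly_measurable N h"
proof (rule strongly_measurable_LIMSEQ)
  show "strongly_measurable N (\<lambda>x. g x)" for n :: nat using assms by simp
  show "AE x in N. (\<lambda>n. g x) \<longlonglongrightarrow> h x"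
    using assms(2) by eventually_elim simp
qed

lemma strongly_measurable_compose_distr:
  assumes g: "strongly_measurable (distr N N' \<phi>) g" and \<phi>: "\<phi> \<in> measurable N N'"
  shows "strongly_measurable N (\<lambda>x. g (\<phi> x))"
proof -
  obtain s where s: "\<And>i. simple_function (distr N N' \<phi>) (s i)"
    "AE x in distr N N' \<phi>. (\<lambda>i. s i x) \<longlonglongrightarrow> g x"
    using g unfolding strongly_measurable_def by blast
  have "simple_function N (\<lambda>x. s i (\<phi> x))" for i
    using s(1)[of i] \<phi> by (intro simple_function_comp[where M = N and M' = "distr N N' \<phi>", unfolded comp_def]) auto
  moreover have "AE x in N. (\<lambda>i. s i (\<phi> x)) \<longlonglongrightarrow> g (\<phi> x)"
    by (rule AE_distrD[OF \<phi> s(2)])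
  ultimately show ?thesis
    unfolding strongly_measurable_def by (intro exI[of _ "\<lambda>i x. s i (\<phi> x)"]) blast
qed

lemma strongly_measurable_isCont_compose:
  fixes \<phi> :: "'a \<Rightarrow> 'b::{metric_space, second_countable_topology}"
  assumes \<phi>: "\<phi> \<in> borel_measurable N" and "AE x in N. isCont g (\<phi> x)"
  shows "strongly_measurable N (\<lambda>x. g (\<phi> x))"
proof -
  obtain s where s: "\<And>i::nat. simple_function N (s i)"
    "\<And>x. x \<in> space N \<Longrightarrow> (\<lambda>i. s i x) \<longlonglongrightarrow> \<phi> x"
    using borel_measurable_implies_sequence_metric[OF \<phi>] by metis
  have "AE x in N. (\<lambda>i. g (s i x)) \<longlonglongrightarrow> g (\<phi> x)"
    using assms(2) AE_space
    by eventually_elim (use s(2) isCont_tendsto_compose in blast)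
  moreover have "simple_function N (\<lambda>x. g (s i x))" for i
    using s(1) by (rule simple_function_compose1)
  ultimately show ?thesis
    unfolding strongly_measurable_def by (intro exI[of _ "\<lambda>i x. g (s i x)"]) blast
qed

lemma strongly_measurable_simple_parameter:
  assumes v: "simple_function N v" and f: "\<And>y. strongly_measurable N (\<lambda>x. f x y)"
  shows "strongly_measurable N (\<lambda>x. f x (v x))"
proof -
  let ?V = "v ` space N"
  have fin: "finite ?V" by (rule simple_functionD(1)[OF v])
  have "strongly_measurable N (\<lambda>x. \<Sum>y\<in>?V. indicat_real (v -` {y} \<inter> space N) x *\<^sub>R f x y)"
    using v by (intro strongly_measurable_sum strongly_measurable_compose2[where p = scaleR]
      f strongly_measurable_simple_function simple_function_indicator tendsto_scaleR)
      (auto intro: simple_functionD)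
  moreover have "AE x in N. (\<Sum>y\<in>?V. indicat_real (v -` {y} \<inter> space N) x *\<^sub>R f x y) = f x (v x)"
  proof (rule AE_I2)
    fix x assume x: "x \<in> space N"
    have "(\<Sum>y\<in>?V. indicat_real (v -` {y} \<inter> space N) x *\<^sub>R f x y) =
        (\<Sum>y\<in>{v x}. indicat_real (v -` {y} \<inter> space N) x *\<^sub>R f x y)"
      by (rule sum.mono_neutral_right[OF fin]) (use x in auto)
    then show "(\<Sum>y\<in>?V. indicat_real (v -` {y} \<inter> space N) x *\<^sub>R f x y) = f x (v x)"
      using x by simp
  qed
  ultimately show ?thesis by (rule strongly_measurable_cong_AE)
qed

lemma strongly_measurable_caratheodory:
  fixes u :: "real \<Rightarrow> 'b::real_normed_vector" and f :: "real \<Rightarrow> 'b \<Rightarrow> 'c::real_normed_vector"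
  assumes f: "\<And>y. strongly_measurable lebesgue (\<lambda>s. f s y)"
    and cont: "\<And>s y. isCont (f s) y" and u: "\<And>s. isCont u s"
  shows "strongly_measurable lebesgue (\<lambda>s. f s (u s))"
proof -
  have "(\<lambda>s::real. s) \<in> borel_measurable lebesgue"
    by (rule measurable_completion) simp
  then obtain v where v: "\<And>i::nat. simple_function lebesgue (v i)"
    "\<And>s::real. (\<lambda>i. v i s) \<longlonglongrightarrow> s"
    using borel_measurable_implies_sequence_metric[of "\<lambda>s. s" lebesgue 0]
    by (metis UNIV_I space_borel space_completion space_lborel)
  show ?thesis
  proof (rule strongly_measurable_LIMSEQ)
    show "strongly_measurable lebesgue (\<lambda>s. f s (u (v n s)))" for n
      by (rule strongly_measurable_simple_parameter) (rule simple_function_compose1[OF v(1)], rule f)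
    have "(\<lambda>n. f s (u (v n s))) \<longlonglongrightarrow> f s (u s)" for s
      by (rule isCont_tendsto_compose[OF cont], rule isCont_tendsto_compose[OF u], rule v(2))
    then show "AE s in lebesgue. (\<lambda>n. f s (u (v n s))) \<longlonglongrightarrow> f s (u s)" by simp
  qed
qed

section \<open>The strong integral\<close>

lemma complete_measure_lebesgue_on:
  assumes "S \<in> sets lebesgue"
  shows "complete_measure (lebesgue_on S)"
proof
  fix A B assume A: "A \<subseteq> B" and B: "B \<in> null_sets (lebesgue_on S)"
  have "B \<in> null_sets lebesgue" "B \<subseteq> S"
    using B assms by (auto simp: null_sets_restrict_space)
  then have "A \<in> null_sets lebesgue"
    using A completion.complete2 by blast
  then show "A \<in> sets (lebesgue_on S)"
    using A \<open>B \<subseteq> S\<close> assms by (auto simp: sets_restrict_space_iff null_setsD2)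
qed

lemma complete_measure_lebesgue: "complete_measure (lebesgue :: real measure)"
  by (rule completion.complete_measure_axioms)

lemma simple_bochner_integral_dist:
  assumes s: "Bochner_Integration.simple_bochner_integrable N s"
    and t: "Bochner_Integration.simple_bochner_integrable N t"
  shows "ennreal (norm (Bochner_Integration.simple_bochner_integral N s
      - Bochner_Integration.simple_bochner_integral N t)) \<le> (\<integral>\<^sup>+x. norm (s x - t x) \<partial>N)"
proof -
  have "ennreal (norm (Bochner_Integration.simple_bochner_integral N s
      - Bochner_Integration.simple_bochner_integral N t))
    = norm (Bochner_Integration.simple_bochner_integral N (\<lambda>x. s x - t x))"
    using s t by (subst simple_bochner_integral_diff) auto
  also have "\<dots> \<le> Bochner_Integration.simple_bochner_integral N (\<lambda>x. norm (s x - t x))"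
    using simple_bochner_integrable_compose2[of "(-)" N s t] s t
    by (auto intro!: simple_bochner_integral_norm_bound)
  also have "\<dots> = (\<integral>\<^sup>+x. norm (s x - t x) \<partial>N)"
    using simple_bochner_integrable_compose2[of "\<lambda>x y. norm (x - y)" N s t] s t
    by (auto intro!: simple_bochner_integral_eq_nn_integral)
  finally show ?thesis .
qed

lemma strongly_measurable_simple_bochner_integrable:
  "Bochner_Integration.simple_bochner_integrable N s \<Longrightarrow> strongly_measurable N s"
  by (auto elim: simple_bochner_integrable.cases intro: strongly_measurable_simple_function)

lemma nn_integral_norm_triangle:
  assumes N: "complete_measure N" and a: "strongly_measurable N a"
    and b: "strongly_measurable N b" and c: "\<And>x. norm (d x) \<le> norm (a x) + norm (b x)"
  shows "(\<integral>\<^sup>+x. norm (d x) \<partial>N) \<le> (\<integral>\<^sup>+x. norm (a x) \<partial>N) + (\<integral>\<^sup>+x. norm (b x) \<partial>N)"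
proof -
  note [measurable] = borel_measurable_norm_strongly_measurable[OF N a]
    borel_measurable_norm_strongly_measurable[OF N b]
  have "(\<integral>\<^sup>+x. norm (d x) \<partial>N) \<le> (\<integral>\<^sup>+x. ennreal (norm (a x)) + ennreal (norm (b x)) \<partial>N)"
    using c by (intro nn_integral_mono) (simp flip: ennreal_plus)
  also have "\<dots> = (\<integral>\<^sup>+x. norm (a x) \<partial>N) + (\<integral>\<^sup>+x. norm (b x) \<partial>N)"
    by (rule nn_integral_add) auto
  finally show ?thesis .
qed

lemma simple_bochner_integral_dist_approx:
  assumes N: "complete_measure N"
    and g: "strongly_measurable N g" "strongly_measurable N h"
    and s: "Bochner_Integration.simple_bochner_integrable N s"
    and t: "Bochner_Integration.simple_bochner_integrable N t"
  shows "ennreal (norm (Bochner_Integration.simple_bochner_integral N s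
      - Bochner_Integration.simple_bochner_integral N t))
    \<le> (\<integral>\<^sup>+x. norm (g x - h x) \<partial>N) + ((\<integral>\<^sup>+x. norm (g x - s x) \<partial>N) + (\<integral>\<^sup>+x. norm (h x - t x) \<partial>N))"
proof -
  note sm = strongly_measurable_diff strongly_measurable_simple_bochner_integrable
  have "ennreal (norm (Bochner_Integration.simple_bochner_integral N s
      - Bochner_Integration.simple_bochner_integral N t)) \<le> (\<integral>\<^sup>+x. norm (s x - t x) \<partial>N)"
    by (rule simple_bochner_integral_dist[OF s t])
  also have "\<dots> \<le> (\<integral>\<^sup>+x. norm (g x - h x) \<partial>N) + (\<integral>\<^sup>+x. norm ((g x - s x) - (h x - t x)) \<partial>N)"
  proof (rule nn_integral_norm_triangle[OF N])
    show "norm (s x - t x) \<le> norm (g x - h x) + norm (g x - s x - (h x - t x))" for x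
      using norm_triangle_ineq4[of "g x - h x" "g x - s x - (h x - t x)"] by simp
  qed (intro sm g s t)+
  also have "(\<integral>\<^sup>+x. norm ((g x - s x) - (h x - t x)) \<partial>N)
      \<le> (\<integral>\<^sup>+x. norm (g x - s x) \<partial>N) + (\<integral>\<^sup>+x. norm (h x - t x) \<partial>N)"
    by (rule nn_integral_norm_triangle[OF N]) (intro sm g s t norm_triangle_ineq4)+
  finally show ?thesis by (simp add: add_left_mono)
qed

lemma has_strong_integral_dist:
  assumes N: "complete_measure N"
    and g: "has_strong_integral N g I" and h: "has_strong_integral N h J"
  shows "ennreal (norm (I - J)) \<le> (\<integral>\<^sup>+x. norm (g x - h x) \<partial>N)"
proof -
  obtain s where s: "\<And>i::nat. Bochner_Integration.simple_bochner_integrable N (s i)"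
    "(\<lambda>i. \<integral>\<^sup>+x. ennreal (norm (g x - s i x)) \<partial>N) \<longlonglongrightarrow> 0"
    "(\<lambda>i. Bochner_Integration.simple_bochner_integral N (s i)) \<longlonglongrightarrow> I"
    and gm: "strongly_measurable N g"
    using g unfolding has_strong_integral_def by blast
  obtain t where t: "\<And>i::nat. Bochner_Integration.simple_bochner_integrable N (t i)"
    "(\<lambda>i. \<integral>\<^sup>+x. ennreal (norm (h x - t i x)) \<partial>N) \<longlonglongrightarrow> 0"
    "(\<lambda>i. Bochner_Integration.simple_bochner_integral N (t i)) \<longlonglongrightarrow> J"
    and hm: "strongly_measurable N h"
    using h unfolding has_strong_integral_def by blast
  have lim1: "(\<lambda>i. ennreal (norm (Bochner_Integration.simple_bochner_integral N (s i)
      - Bochner_Integration.simple_bochner_integral N (t i)))) \<longlonglongrightarrow> ennreal (norm (I - J))"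
    by (intro tendsto_intros s t)
  have lim2: "(\<lambda>i. (\<integral>\<^sup>+x. norm (g x - h x) \<partial>N) +
      ((\<integral>\<^sup>+x. norm (g x - s i x) \<partial>N) + (\<integral>\<^sup>+x. norm (h x - t i x) \<partial>N)))
      \<longlonglongrightarrow> (\<integral>\<^sup>+x. norm (g x - h x) \<partial>N) + (0 + 0)"
    by (intro tendsto_intros s t)
  have "ennreal (norm (I - J)) \<le> (\<integral>\<^sup>+x. norm (g x - h x) \<partial>N) + (0 + 0)"
    using simple_bochner_integral_dist_approx[OF N gm hm s(1) t(1)]
    by (intro LIMSEQ_le[OF lim1 lim2]) blast
  then show ?thesis by simp
qed

lemma has_strong_integral_unique:
  assumes "complete_measure N" "has_strong_integral N g I" "has_strong_integral N g J"
  shows "I = J"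
  using has_strong_integral_dist[OF assms] by simp

lemma strong_integral_eq:
  assumes "complete_measure N" "has_strong_integral N g I"
  shows "strong_integral N g = I"
  unfolding strong_integral_def
  using assms has_strong_integral_unique by (intro the_equality) blast+

lemma has_strong_integral_exists:
  fixes g :: "'a \<Rightarrow> 'b::banach"
  assumes N: "complete_measure N" and g: "strongly_measurable N g"
    and fin: "(\<integral>\<^sup>+x. norm (g x) \<partial>N) < \<infinity>"
  shows "\<exists>I. has_strong_integral N g I"
proof -
  obtain h D where h: "h \<in> borel_measurable N" "countable D" "0 \<in> D"
    "\<And>x. x \<in> space N \<Longrightarrow> h x \<in> closure D" and gh: "AE x in N. g x = h x"
    using strongly_measurable_borelE[OF g] by metis
  obtain s where s: "\<And>i::nat. simple_function N (s i)"
    and lim: "\<And>x. x \<in> space N \<Longrightarrow> (\<lambda>i. s i x) \<longlonglongrightarrow> h x"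
    and le: "\<And>i x. dist (s i x) (h x) \<le> dist 0 (h x)"
    using separable_borel_approx[OF h] by metis
  have le': "norm (h x - s i x) \<le> norm (h x)" for i x
    using le[of i x] by (simp add: dist_norm norm_minus_commute)
  note gn[measurable] = borel_measurable_norm_strongly_measurable[OF N g]
  have gsm: "strongly_measurable N (\<lambda>x. g x - s i x)" for i
    by (intro strongly_measurable_diff g strongly_measurable_simple_function s)
  have sbi: "Bochner_Integration.simple_bochner_integrable N (s i)" for i
  proof (rule simple_bochner_integrableI_bounded[OF s])
    have "(\<integral>\<^sup>+x. norm (s i x) \<partial>N) \<le> (\<integral>\<^sup>+x. 2 * ennreal (norm (g x)) \<partial>N)"
    proof (rule nn_integral_mono_AE)
      have "norm (s i x) \<le> 2 * norm (h x)" for x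
        using le'[of x i] norm_triangle_ineq4[of "h x" "h x - s i x"] by simp
      then have "ennreal (norm (s i x)) \<le> 2 * ennreal (norm (h x))" for x
        by (metis ennreal_leI ennreal_mult ennreal_numeral norm_ge_zero zero_le_numeral)
      then show "AE x in N. ennreal (norm (s i x)) \<le> 2 * ennreal (norm (g x))"
        using gh by (auto elim: eventually_mono)
    qed
    also have "\<dots> = 2 * (\<integral>\<^sup>+x. norm (g x) \<partial>N)"
      by (rule nn_integral_cmult) auto
    also have "\<dots> < \<infinity>" using fin by (simp add: ennreal_mult_less_top)
    finally show "(\<integral>\<^sup>+x. norm (s i x) \<partial>N) < \<infinity>" .
  qed
  have conv: "(\<lambda>i. \<integral>\<^sup>+x. norm (g x - s i x) \<partial>N) \<longlonglongrightarrow> (\<integral>\<^sup>+x. 0 \<partial>N)"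
  proof (rule nn_integral_dominated_convergence[where w = "\<lambda>x. ennreal (norm (g x))"])
    show "(\<lambda>x. ennreal (norm (g x - s i x))) \<in> borel_measurable N" for i
      using borel_measurable_norm_strongly_measurable[OF N gsm[of i]] by simp
    show "AE x in N. ennreal (norm (g x - s j x)) \<le> ennreal (norm (g x))" for j
      using gh by eventually_elim (use le' in \<open>simp add: ennreal_leI\<close>)
    have lim0: "(\<lambda>i. ennreal (norm (h x - s i x))) \<longlonglongrightarrow> 0" if "x \<in> space N" for x
    proof -
      have "(\<lambda>i. ennreal (norm (h x - s i x))) \<longlonglongrightarrow> ennreal (norm (h x - h x))"
        using lim[OF that] by (intro tendsto_intros)
      then show ?thesis by simp
    qed
    show "AE x in N. (\<lambda>i. ennreal (norm (g x - s i x))) \<longlonglongrightarrow> 0"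
      using gh AE_space by eventually_elim (use lim0 in simp)
  qed (use fin in auto)
  have "Cauchy (\<lambda>i. Bochner_Integration.simple_bochner_integral N (s i))"
  proof (rule metric_CauchyI)
    fix e :: real assume "0 < e"
    then have "\<forall>\<^sub>F i in sequentially. (\<integral>\<^sup>+x. norm (g x - s i x) \<partial>N) < ennreal (e / 2)"
      using conv by (intro order_tendstoD(2)) auto
    then obtain n where n: "\<And>i. i \<ge> n \<Longrightarrow> (\<integral>\<^sup>+x. norm (g x - s i x) \<partial>N) < ennreal (e / 2)"
      unfolding eventually_sequentially by blast
    show "\<exists>M. \<forall>m\<ge>M. \<forall>n\<ge>M. dist (Bochner_Integration.simple_bochner_integral N (s m))
        (Bochner_Integration.simple_bochner_integral N (s n)) < e"
    proof (intro exI[of _ n] allI impI)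
      fix i j assume ij: "n \<le> i" "n \<le> j"
      have "ennreal (norm (Bochner_Integration.simple_bochner_integral N (s i)
          - Bochner_Integration.simple_bochner_integral N (s j)))
        \<le> (\<integral>\<^sup>+x. norm (g x - s i x) \<partial>N) + (\<integral>\<^sup>+x. norm (g x - s j x) \<partial>N)"
        using simple_bochner_integral_dist_approx[OF N g g sbi[of i] sbi[of j]] by simp
      also have "\<dots> < ennreal (e / 2) + ennreal (e / 2)"
        using n ij by (intro add_strict_mono) auto
      also have "\<dots> = ennreal e" using \<open>0 < e\<close> by (simp flip: ennreal_plus)
      finally show "dist (Bochner_Integration.simple_bochner_integral N (s i))
          (Bochner_Integration.simple_bochner_integral N (s j)) < e"
        by (simp add: dist_norm ennreal_less_iff)
    qed
  qed
  then obtain I where "(\<lambda>i. Bochner_Integration.simple_bochner_integral N (s i)) \<longlonglongrightarrow> I"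
    using Cauchy_convergent convergent_def by blast
  then show ?thesis
    unfolding has_strong_integral_def using g sbi conv by auto
qed

lemma has_strong_integral_strong_integral:
  fixes g :: "'a \<Rightarrow> 'b::banach"
  assumes "complete_measure N" "strongly_measurable N g" "(\<integral>\<^sup>+x. norm (g x) \<partial>N) < \<infinity>"
  shows "has_strong_integral N g (strong_integral N g)"
  using has_strong_integral_exists[OF assms] strong_integral_eq[OF assms(1)] by blast

lemma has_strong_integral_compose_distr:
  assumes \<phi>: "\<phi> \<in> measurable N N'" and g: "has_strong_integral (distr N N' \<phi>) g I"
    and surj: "\<phi> ` space N = space N'" and N: "complete_measure (distr N N' \<phi>)"
  shows "has_strong_integral N (\<lambda>x. g (\<phi> x)) I"
proof -
  let ?N = "distr N N' \<phi>"
  obtain s where s: "\<And>i::nat. Bochner_Integration.simple_bochner_integrable ?N (s i)"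
    "(\<lambda>i. \<integral>\<^sup>+x. ennreal (norm (g x - s i x)) \<partial>?N) \<longlonglongrightarrow> 0"
    "(\<lambda>i. Bochner_Integration.simple_bochner_integral ?N (s i)) \<longlonglongrightarrow> I"
    and gm: "strongly_measurable ?N g"
    using g unfolding has_strong_integral_def by blast
  have sf: "simple_function ?N (s i)" for i
    using s(1)[of i] by (auto elim: simple_bochner_integrable.cases)
  have pre: "{x \<in> space N. P (\<phi> x)} = \<phi> -` {y \<in> space ?N. P y} \<inter> space N" for P
    using measurable_space[OF \<phi>] by auto
  have meas: "{y \<in> space ?N. P (s i y)} \<in> sets N'" for P i
  proof -
    have "s i -` {z. P z} \<inter> space ?N \<in> sets ?N"
      by (rule measurable_sets[OF measurable_simple_function[OF sf]]) simp
    moreover have "s i -` {z. P z} \<inter> space ?N = {y \<in> space ?N. P (s i y)}" by auto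
    ultimately show ?thesis by simp
  qed
  show ?thesis
    unfolding has_strong_integral_def
  proof (intro conjI exI[of _ "\<lambda>i x. s i (\<phi> x)"] allI)
    show "strongly_measurable N (\<lambda>x. g (\<phi> x))"
      by (rule strongly_measurable_compose_distr[OF gm \<phi>])
    show "Bochner_Integration.simple_bochner_integrable N (\<lambda>x. s i (\<phi> x))" for i
    proof
      show "simple_function N (\<lambda>x. s i (\<phi> x))"
        using sf[of i] \<phi> by (intro simple_function_comp[where M = N and M' = ?N, unfolded comp_def]) auto
      have "emeasure N {x \<in> space N. s i (\<phi> x) \<noteq> 0} = emeasure ?N {y \<in> space ?N. s i y \<noteq> 0}"
        by (simp only: pre[of "\<lambda>y. s i y \<noteq> 0"]
          emeasure_distr[OF \<phi> meas[of "\<lambda>z. z \<noteq> 0" i]])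
      then show "emeasure N {x \<in> space N. s i (\<phi> x) \<noteq> 0} \<noteq> \<infinity>"
        using s(1)[of i] by (auto elim: simple_bochner_integrable.cases)
    qed
    have "Bochner_Integration.simple_bochner_integral N (\<lambda>x. s i (\<phi> x))
        = Bochner_Integration.simple_bochner_integral ?N (s i)" for i
    proof -
      have "(\<lambda>x. s i (\<phi> x)) ` space N = s i ` space ?N"
        using surj by (auto simp: image_image[symmetric])
      moreover have "measure N {x \<in> space N. s i (\<phi> x) = y} = measure ?N {x \<in> space ?N. s i x = y}" for y
        by (simp only: pre[of "\<lambda>x. s i x = y"]
          measure_distr[OF \<phi> meas[of "\<lambda>z. z = y" i]])
      ultimately show ?thesis
        unfolding simple_bochner_integral_def by simp
    qed
    then show "(\<lambda>i. Bochner_Integration.simple_bochner_integral N (\<lambda>x. s i (\<phi> x))) \<longlonglongrightarrow> I"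
      using s(3) by simp
    have "(\<integral>\<^sup>+x. norm (g x - s i x) \<partial>?N) = (\<integral>\<^sup>+x. norm (g (\<phi> x) - s i (\<phi> x)) \<partial>N)" for i
      using borel_measurable_norm_strongly_measurable[OF N
          strongly_measurable_diff[OF gm strongly_measurable_simple_function[OF sf[of i]]]]
      by (intro nn_integral_distr[OF \<phi>]) simp
    then show "(\<lambda>i. \<integral>\<^sup>+x. norm (g (\<phi> x) - s i (\<phi> x)) \<partial>N) \<longlonglongrightarrow> 0"
      using s(2) by simp
  qed
qed

lemma lebesgue_reflect_measurable: "(\<lambda>s::real. t - s) \<in> measurable lebesgue lebesgue"
  using lebesgue_affine_measurable[of "\<lambda>_::real. - 1" t] by simp

lemma lebesgue_shift_measurable: "(\<lambda>s::real. t + s) \<in> measurable lebesgue lebesgue"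
  using lebesgue_affine_measurable[of "\<lambda>_::real. 1" t] by simp

lemma distr_lebesgue_reflect: "distr lebesgue lebesgue (\<lambda>s::real. t - s) = lebesgue"
  using lebesgue_real_affine[of "- 1" t] by (simp add: density_1)

lemma distr_lebesgue_shift: "distr lebesgue lebesgue (\<lambda>s::real. t + s) = lebesgue"
  using lebesgue_real_affine[of 1 t] by (simp add: density_1)

lemma measurable_restrict_vimage:
  assumes \<phi>: "\<phi> \<in> measurable N N" and N: "distr N N \<phi> = N" and S: "S \<in> sets N" "\<phi> -` S \<inter> space N = R"
  shows "\<phi> \<in> measurable (restrict_space N R) (restrict_space N S)"
    and "distr (restrict_space N R) (restrict_space N S) \<phi> = restrict_space N S"
proof -
  have R: "R \<in> sets N" using measurable_sets[OF \<phi> S(1)] S(2) by simp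
  show m: "\<phi> \<in> measurable (restrict_space N R) (restrict_space N S)"
    using S by (intro measurable_restrict_space3 \<phi>) auto
  show "distr (restrict_space N R) (restrict_space N S) \<phi> = restrict_space N S"
  proof (rule measure_eqI)
    fix A assume "A \<in> sets (distr (restrict_space N R) (restrict_space N S) \<phi>)"
    then have A: "A \<in> sets (restrict_space N S)" by simp
    then have AN: "A \<in> sets N" "A \<subseteq> S"
      using S(1) by (auto simp: sets_restrict_space_iff)
    have eq: "\<phi> -` A \<inter> space (restrict_space N R) = \<phi> -` A \<inter> space N"
      using AN S R sets.sets_into_space[OF R] by (auto simp: space_restrict_space)
    have "emeasure (distr (restrict_space N R) (restrict_space N S) \<phi>) A
        = emeasure (restrict_space N R) (\<phi> -` A \<inter> space N)"
      by (simp add: emeasure_distr[OF m A] eq)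
    also have "\<dots> = emeasure N (\<phi> -` A \<inter> space N)"
      using AN S R by (intro emeasure_restrict_space) auto
    also have "\<dots> = emeasure (distr N N \<phi>) A"
      by (simp add: emeasure_distr[OF \<phi> AN(1)])
    also have "\<dots> = emeasure (restrict_space N S) A"
      using AN S by (simp add: N emeasure_restrict_space)
    finally show "emeasure (distr (restrict_space N R) (restrict_space N S) \<phi>) A
      = emeasure (restrict_space N S) A" .
  qed simp
qed

lemma has_strong_integral_reflect:
  assumes "has_strong_integral (lebesgue_on {0<..}) g I"
  shows "has_strong_integral (lebesgue_on {..<t}) (\<lambda>s::real. g (t - s)) I"
proof -
  note r = measurable_restrict_vimage[OF lebesgue_reflect_measurable distr_lebesgue_reflect,
      of "{0<..}" t "{..<t}"]
  have m: "(\<lambda>s. t - s) \<in> measurable (lebesgue_on {..<t}) (lebesgue_on {0<..})"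
    "distr (lebesgue_on {..<t}) (lebesgue_on {0<..}) (\<lambda>s. t - s) = lebesgue_on {0<..}"
    by (rule r; auto)+
  show ?thesis
  proof (rule has_strong_integral_compose_distr[OF m(1)])
    show "has_strong_integral (distr (lebesgue_on {..<t}) (lebesgue_on {0<..}) (\<lambda>s. t - s)) g I"
      unfolding m(2) by (rule assms)
    show "complete_measure (distr (lebesgue_on {..<t}) (lebesgue_on {0<..}) (\<lambda>s. t - s))"
      unfolding m(2) by (rule complete_measure_lebesgue_on) simp
    have "x \<in> (\<lambda>s. t - s) ` {..<t}" if "x > 0" for x
      using that by (intro image_eqI[of _ _ "t - x"]) auto
    then show "(\<lambda>s. t - s) ` space (lebesgue_on {..<t}) = space (lebesgue_on {0<..})"
      by (auto simp: space_restrict_space)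
  qed
qed

section \<open>Hoelder's inequality\<close>

lemma Lq_norm_1:
  "Lq_norm (ereal 1) N g = (\<integral>\<^sup>+x. norm (g x) \<partial>N)"
  by (simp add: Lq_norm_def Let_def less_top[symmetric])

lemma nn_integral_Hoelder:
  assumes p: "p \<ge> 1" and q: "q = (if p = 1 then \<infinity> else ereal (p / (p - 1)))"
    and [measurable]: "(\<lambda>x. norm (a x)) \<in> borel_measurable N" "(\<lambda>x. norm (b x)) \<in> borel_measurable N"
    and fin: "Lq_norm q N a < \<infinity>" "Lq_norm (ereal p) N b < \<infinity>"
  shows "(\<integral>\<^sup>+x. ennreal (norm (a x) * norm (b x)) \<partial>N) \<le> Lq_norm q N a * Lq_norm (ereal p) N b"
proof (cases "p = 1")
  case True
  have "(\<integral>\<^sup>+x. ennreal (norm (a x) * norm (b x)) \<partial>N)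
      \<le> (\<integral>\<^sup>+x. Lq_norm q N a * ennreal (norm (b x)) \<partial>N)"
  proof (rule nn_integral_mono_AE)
    show "AE x in N. ennreal (norm (a x) * norm (b x)) \<le> Lq_norm q N a * ennreal (norm (b x))"
      using esssup_AE[of "\<lambda>x. ennreal (norm (a x))" N]
      by eventually_elim (simp add: True q Lq_norm_def ennreal_mult mult_right_mono)
  qed
  also have "\<dots> = Lq_norm q N a * Lq_norm (ereal p) N b"
    by (simp add: True Lq_norm_1[unfolded one_ereal_def[symmetric]] nn_integral_cmult one_ereal_def[symmetric])
  finally show ?thesis .
next
  case False
  define r where "r = p / (p - 1)"
  have p1: "p > 1" using p False by simp
  then have r1: "r > 1" by (simp add: r_def field_simps)
  have pr: "1 / r + 1 / p = 1" using p1 by (simp add: r_def field_simps)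
  define A where "A = enn2real (\<integral>\<^sup>+x. ennreal (norm (a x) powr r) \<partial>N)"
  define B where "B = enn2real (\<integral>\<^sup>+x. ennreal (norm (b x) powr p) \<partial>N)"
  have A: "(\<integral>\<^sup>+x. ennreal (norm (a x) powr r) \<partial>N) = ennreal A" "Lq_norm q N a = ennreal (A powr (1 / r))"
    using fin(1) False
    by (auto simp: q Lq_norm_def Let_def A_def r_def less_top split: if_splits)
  have B: "(\<integral>\<^sup>+x. ennreal (norm (b x) powr p) \<partial>N) = ennreal B" "Lq_norm p N b = ennreal (B powr (1 / p))"
    using fin(2)
    by (auto simp: Lq_norm_def Let_def B_def less_top split: if_splits)
  have nn: "A \<ge> 0" "B \<ge> 0" by (simp_all add: A_def B_def)
  show ?thesis
  proof (cases "A = 0 \<or> B = 0")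
    case True
    have "AE x in N. ennreal (norm (a x) * norm (b x)) = 0"
    proof (cases "A = 0")
      case True
      then have "AE x in N. ennreal (norm (a x) powr r) = 0"
        using A(1) by (subst nn_integral_0_iff_AE[symmetric]) auto
      then show ?thesis by eventually_elim simp
    next
      case False
      then have "AE x in N. ennreal (norm (b x) powr p) = 0"
        using B(1) \<open>A = 0 \<or> B = 0\<close> by (subst nn_integral_0_iff_AE[symmetric]) auto
      then show ?thesis by eventually_elim simp
    qed
    then have "(\<integral>\<^sup>+x. ennreal (norm (a x) * norm (b x)) \<partial>N) = 0"
      by (subst nn_integral_0_iff_AE) auto
    then show ?thesis by simp
  next
    case False
    then have pos: "A > 0" "B > 0" using nn by auto
    define \<alpha> where "\<alpha> = A powr (1 / r)"
    define \<gamma> where "\<gamma> = B powr (1 / p)"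
    have \<alpha>\<gamma>: "\<alpha> > 0" "\<gamma> > 0" "\<alpha> powr r = A" "\<gamma> powr p = B"
      using pos r1 p1 by (auto simp: \<alpha>_def \<gamma>_def powr_powr)
    have pw: "norm (a x) * norm (b x)
        \<le> \<alpha> * \<gamma> * (1 / (r * A) * norm (a x) powr r + 1 / (p * B) * norm (b x) powr p)" for x
    proof -
      have "norm (a x) / \<alpha> * (norm (b x) / \<gamma>)
          \<le> (norm (a x) / \<alpha>) powr r / r + (norm (b x) / \<gamma>) powr p / p"
        using r1 p1 pr \<alpha>\<gamma> by (intro Youngs_inequality) auto
      also have "\<dots> = 1 / (r * A) * norm (a x) powr r + 1 / (p * B) * norm (b x) powr p"
        using \<alpha>\<gamma> by (simp add: powr_divide mult.commute)
      finally have "\<alpha> * \<gamma> * (norm (a x) / \<alpha> * (norm (b x) / \<gamma>))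
          \<le> \<alpha> * \<gamma> * (1 / (r * A) * norm (a x) powr r + 1 / (p * B) * norm (b x) powr p)"
        using \<alpha>\<gamma> by (intro mult_left_mono) auto
      then show ?thesis using \<alpha>\<gamma> by simp
    qed
    have "(\<integral>\<^sup>+x. ennreal (norm (a x) * norm (b x)) \<partial>N)
        \<le> (\<integral>\<^sup>+x. ennreal (\<alpha> * \<gamma>) * (ennreal (1 / (r * A)) * ennreal (norm (a x) powr r)
            + ennreal (1 / (p * B)) * ennreal (norm (b x) powr p)) \<partial>N)"
    proof (rule nn_integral_mono)
      fix x
      have "ennreal (norm (a x) * norm (b x)) \<le> ennreal (\<alpha> * \<gamma> *
          (1 / (r * A) * norm (a x) powr r + 1 / (p * B) * norm (b x) powr p))"
        by (rule ennreal_leI[OF pw])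
      also have "\<dots> = ennreal (\<alpha> * \<gamma>) * (ennreal (1 / (r * A)) * ennreal (norm (a x) powr r)
            + ennreal (1 / (p * B)) * ennreal (norm (b x) powr p))"
        using pos \<alpha>\<gamma> r1 p1
        by (simp add: ennreal_mult ennreal_plus del: times_divide_eq_left mult_divide_mult_cancel_left_if)
      finally show "ennreal (norm (a x) * norm (b x)) \<le> ennreal (\<alpha> * \<gamma>) *
          (ennreal (1 / (r * A)) * ennreal (norm (a x) powr r)
            + ennreal (1 / (p * B)) * ennreal (norm (b x) powr p))" .
    qed
    also have "\<dots> = ennreal (\<alpha> * \<gamma>) * (ennreal (1 / (r * A)) * ennreal A + ennreal (1 / (p * B)) * ennreal B)"
      by (simp add: nn_integral_cmult nn_integral_add A(1) B(1))
    also have "ennreal (1 / (r * A)) * ennreal A + ennreal (1 / (p * B)) * ennreal B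
        = ennreal (1 / (r * A) * A + 1 / (p * B) * B)"
      using pos r1 p1 by (simp add: ennreal_mult[symmetric] ennreal_plus[symmetric] del: ennreal_plus)
    also have "1 / (r * A) * A + 1 / (p * B) * B = 1"
      using pos pr by simp
    finally show ?thesis
      using \<alpha>\<gamma> by (simp add: A(2) B(2) \<alpha>_def \<gamma>_def ennreal_mult)
  qed
qed

lemma Lq_norm_distr:
  assumes "\<phi> \<in> measurable N N'" "(\<lambda>x. norm (g x)) \<in> borel_measurable N'"
  shows "Lq_norm (ereal p) (distr N N' \<phi>) g = Lq_norm (ereal p) N (\<lambda>x. g (\<phi> x))"
  using assms by (simp add: Lq_norm_def nn_integral_distr)

lemma Lq_norm_zero: "p > 0 \<Longrightarrow> Lq_norm (ereal p) N (\<lambda>x. 0) = 0"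
  by (simp add: Lq_norm_def)

lemma Lq_norm_const_le:
  assumes "p \<ge> 1" "emeasure N (space N) = 1" "\<And>x. norm (g x) \<le> C"
  shows "Lq_norm (ereal p) N g \<le> ennreal C"
proof -
  have C: "C \<ge> 0" using assms(3) norm_ge_zero order_trans by blast
  have "(\<integral>\<^sup>+x. ennreal (norm (g x) powr p) \<partial>N) \<le> (\<integral>\<^sup>+x. ennreal (C powr p) \<partial>N)"
    using assms(1,3) by (intro nn_integral_mono ennreal_leI powr_mono2) auto
  then have le: "(\<integral>\<^sup>+x. ennreal (norm (g x) powr p) \<partial>N) \<le> ennreal (C powr p)"
    using assms(2) by simp
  then have "enn2real (\<integral>\<^sup>+x. ennreal (norm (g x) powr p) \<partial>N) \<le> C powr p"
    by (rule enn2real_leI[rotated]) simp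
  then have "enn2real (\<integral>\<^sup>+x. ennreal (norm (g x) powr p) \<partial>N) powr (1 / p) \<le> (C powr p) powr (1 / p)"
    using assms(1) by (intro powr_mono2) auto
  also have "\<dots> = C" using assms(1) C by (simp add: powr_powr)
  finally show ?thesis
    using le by (auto simp: Lq_norm_def Let_def ennreal_leI top_unique)
qed

section \<open>Continuity of the degenerate semigroup\<close>

lemma bounded_bilinear_scaleC:
  "bounded_bilinear (\<lambda>a (x :: 'a :: complex_normed_vector). a *\<^sub>C x)"
proof
  show "(r *\<^sub>R a) *\<^sub>C x = r *\<^sub>R (a *\<^sub>C x)" for r a and x :: 'a
    unfolding scaleR_conv_of_real scaleR_scaleC[of r "a *\<^sub>C x"] scaleC_scaleC ..
  show "a *\<^sub>C (r *\<^sub>R x) = r *\<^sub>R (a *\<^sub>C x)" for r a and x :: 'a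
    by (simp add: scaleR_scaleC scaleC_scaleC mult.commute)
  show "\<exists>K. \<forall>a (x :: 'a). norm (a *\<^sub>C x) \<le> norm a * norm x * K"
    by (intro exI[of _ 1]) (simp add: norm_scaleC)
qed (simp_all add: scaleC_add_right scaleC_add_left)

lemma scaleC_minus_one: "(- 1) *\<^sub>C x = - (x :: 'a :: complex_normed_vector)"
  using scaleR_scaleC[of "- 1" x] by simp

lemma scaleC_diff_left: "(a - b) *\<^sub>C x = a *\<^sub>C x - b *\<^sub>C (x :: 'a :: complex_normed_vector)"
  by (rule bounded_bilinear.diff_left[OF bounded_bilinear_scaleC])

lemma scaleC_diff_right: "a *\<^sub>C (x - y) = a *\<^sub>C x - a *\<^sub>C (y :: 'a :: complex_normed_vector)"
  by (rule bounded_bilinear.diff_right[OF bounded_bilinear_scaleC])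

lemma mlo_inverse_resolvent:
  assumes "z \<in> resolvent_set \<A>"
  shows "mlo_inverse (scalar_minus z \<A>) x = {blinfun_apply (resolvent \<A> z) x}"
proof -
  obtain R where "bounded_linear R" and R: "\<And>x. mlo_inverse (scalar_minus z \<A>) x = {R x}"
    using assms by (auto simp: resolvent_set_def bounded_clinear_def)
  then have B: "\<forall>x. mlo_inverse (scalar_minus z \<A>) x = {blinfun_apply (Blinfun R) x}"
    by (simp add: bounded_linear_Blinfun_apply)
  have "resolvent \<A> z = Blinfun R"
    unfolding resolvent_def
  proof (rule the_equality)
    show "R' = Blinfun R"
      if "\<forall>x. mlo_inverse (scalar_minus z \<A>) x = {blinfun_apply R' x}" for R'
      using that B by (intro blinfun_eqI) (metis singleton_inject)
  qed (rule B)
  then show ?thesis using B by simp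
qed

lemma resolvent_iff:
  assumes "z \<in> resolvent_set \<A>"
  shows "z *\<^sub>C w - x \<in> \<A> w \<longleftrightarrow> w = blinfun_apply (resolvent \<A> z) x"
proof -
  have "z *\<^sub>C w - x \<in> \<A> w \<longleftrightarrow> w \<in> mlo_inverse (scalar_minus z \<A>) x"
    by (force simp: mlo_inverse_def scalar_minus_def)
  then show ?thesis
    unfolding mlo_inverse_resolvent[OF assms] by simp
qed

lemma MLO_diff:
  assumes "MLO \<A>" "y \<in> \<A> x" "y' \<in> \<A> x'"
  shows "y - y' \<in> \<A> (x - x')"
proof -
  have "(- 1) *\<^sub>C y' \<in> \<A> ((- 1) *\<^sub>C x')"
    using assms unfolding MLO_def by blast
  then have "y + (- 1) *\<^sub>C y' \<in> \<A> (x + (- 1) *\<^sub>C x')"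
    using assms unfolding MLO_def by blast
  then show ?thesis by (simp add: scaleC_minus_one)
qed

lemma resolvent_identity:
  assumes \<A>: "MLO \<A>" and z: "z \<in> resolvent_set \<A>" "w \<in> resolvent_set \<A>"
  shows "blinfun_apply (resolvent \<A> z) x - blinfun_apply (resolvent \<A> w) x
    = blinfun_apply (resolvent \<A> w) ((w - z) *\<^sub>C blinfun_apply (resolvent \<A> z) x)"
proof -
  let ?u = "blinfun_apply (resolvent \<A> z) x" and ?v = "blinfun_apply (resolvent \<A> w) x"
  have "z *\<^sub>C ?u - x \<in> \<A> ?u" "w *\<^sub>C ?v - x \<in> \<A> ?v"
    by (simp_all add: resolvent_iff z)
  from MLO_diff[OF \<A> this]
  have "z *\<^sub>C ?u - w *\<^sub>C ?v \<in> \<A> (?u - ?v)" by simp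
  also have "z *\<^sub>C ?u - w *\<^sub>C ?v = w *\<^sub>C (?u - ?v) - (w - z) *\<^sub>C ?u"
    by (simp add: scaleC_diff_left scaleC_diff_right)
  finally show ?thesis by (simp add: resolvent_iff z)
qed

lemma resolvent_lipschitz:
  assumes \<A>: "MLO \<A>" and z: "z \<in> resolvent_set \<A>" "w \<in> resolvent_set \<A>"
  shows "norm (resolvent \<A> z - resolvent \<A> w)
    \<le> norm (resolvent \<A> w) * (cmod (w - z) * norm (resolvent \<A> z))"
proof (rule norm_blinfun_bound)
  fix x
  have "norm (blinfun_apply (resolvent \<A> z - resolvent \<A> w) x)
      = norm (blinfun_apply (resolvent \<A> w) ((w - z) *\<^sub>C blinfun_apply (resolvent \<A> z) x))"
    by (simp add: blinfun.diff_left resolvent_identity[OF assms])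
  also have "\<dots> \<le> norm (resolvent \<A> w) * (cmod (w - z) * norm (blinfun_apply (resolvent \<A> z) x))"
    using norm_blinfun[of "resolvent \<A> w" "(w - z) *\<^sub>C blinfun_apply (resolvent \<A> z) x"]
    by (simp add: norm_scaleC)
  also have "\<dots> \<le> norm (resolvent \<A> w) * (cmod (w - z) * (norm (resolvent \<A> z) * norm x))"
    by (intro mult_left_mono norm_blinfun) auto
  finally show "norm (blinfun_apply (resolvent \<A> z - resolvent \<A> w) x)
      \<le> norm (resolvent \<A> w) * (cmod (w - z) * norm (resolvent \<A> z)) * norm x"
    by (simp add: mult.assoc)
qed simp

lemma nn_integral_exp_abs_finite:
  assumes "k > (0::real)"
  shows "(\<integral>\<^sup>+\<eta>. ennreal (exp (- k * \<bar>\<eta>\<bar>)) \<partial>lebesgue) < \<infinity>"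
proof -
  let ?h = "\<lambda>x::real. ennreal (indicator {0..} x * exp (- k * x))"
  have h: "(\<integral>\<^sup>+x. ?h x \<partial>lebesgue) = ennreal (exp (- k * 0) / k)"
    using nn_integral_has_integral_lebesgue[OF _ has_integral_exp_minus_to_infinity[OF assms, of 0]]
    by (simp add: nn_integral_completion)
  have m: "?h \<in> borel_measurable lebesgue" by (rule measurable_completion) simp
  have "(\<integral>\<^sup>+x. ?h (0 - x) \<partial>lebesgue) = (\<integral>\<^sup>+x. ?h x \<partial>distr lebesgue lebesgue (\<lambda>x. 0 - x))"
    using m by (intro nn_integral_distr[symmetric] lebesgue_reflect_measurable) simp
  then have h': "(\<integral>\<^sup>+x. ?h (0 - x) \<partial>lebesgue) = ennreal (exp (- k * 0) / k)"
    by (simp only: distr_lebesgue_reflect h)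
  have "(\<integral>\<^sup>+\<eta>. ennreal (exp (- k * \<bar>\<eta>\<bar>)) \<partial>lebesgue) \<le> (\<integral>\<^sup>+\<eta>. ?h \<eta> + ?h (0 - \<eta>) \<partial>lebesgue)"
  proof (rule nn_integral_mono)
    show "ennreal (exp (- k * \<bar>\<eta>\<bar>)) \<le> ?h \<eta> + ?h (0 - \<eta>)" for \<eta>
      by (cases "\<eta> \<ge> 0") (auto simp: indicator_def)
  qed
  also have "\<dots> = (\<integral>\<^sup>+\<eta>. ?h \<eta> \<partial>lebesgue) + (\<integral>\<^sup>+\<eta>. ?h (0 - \<eta>) \<partial>lebesgue)"
    by (rule nn_integral_add[OF m measurable_compose[OF lebesgue_reflect_measurable m]])
  also have "\<dots> < \<infinity>" unfolding h h' by simp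
  finally show ?thesis .
qed

context
  fixes \<A> :: "'a :: complex_banach \<Rightarrow> 'a set" and c M\<^sub>0 \<beta> :: real
  assumes \<A>: "MLO \<A>" and P: "condition_P \<A> c M\<^sub>0 \<beta>"
begin

lemma \<Gamma>_curve_resolvent_set: "\<Gamma>_curve c \<eta> \<in> resolvent_set \<A>"
  using P by (auto simp: condition_P_def \<Gamma>_curve_def)

lemma norm_resolvent_\<Gamma>_curve: "norm (resolvent \<A> (\<Gamma>_curve c \<eta>)) \<le> M\<^sub>0"
proof -
  have "norm (resolvent \<A> (\<Gamma>_curve c \<eta>)) \<le> M\<^sub>0 * (1 + cmod (\<Gamma>_curve c \<eta>)) powr (- \<beta>)"
    using P by (simp add: condition_P_def \<Gamma>_curve_def)
  also have "\<dots> \<le> M\<^sub>0 * 1"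
    using P by (intro mult_left_mono) (auto simp: condition_P_def powr_minus ge_one_powr_ge_zero
      inverse_le_1_iff)
  finally show ?thesis by simp
qed

lemma isCont_resolvent_\<Gamma>_curve: "isCont (\<lambda>\<eta>. resolvent \<A> (\<Gamma>_curve c \<eta>)) \<eta>"
proof -
  have M: "M\<^sub>0 > 0" using P by (simp add: condition_P_def)
  have "isCont (\<Gamma>_curve c) \<eta>"
    unfolding \<Gamma>_curve_def Complex_eq by (intro continuous_intros)
  then have \<Gamma>: "(\<Gamma>_curve c \<longlongrightarrow> \<Gamma>_curve c \<eta>) (at \<eta>)" by (simp add: isCont_def)
  have "((\<lambda>\<xi>. M\<^sub>0 * (cmod (\<Gamma>_curve c \<eta> - \<Gamma>_curve c \<xi>) * M\<^sub>0)) \<longlongrightarrow>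
      M\<^sub>0 * (cmod (\<Gamma>_curve c \<eta> - \<Gamma>_curve c \<eta>) * M\<^sub>0)) (at \<eta>)"
    by (intro tendsto_intros \<Gamma>)
  then have lim: "((\<lambda>\<xi>. M\<^sub>0 * (cmod (\<Gamma>_curve c \<eta> - \<Gamma>_curve c \<xi>) * M\<^sub>0)) \<longlongrightarrow> 0) (at \<eta>)"
    by simp
  have "((\<lambda>\<xi>. resolvent \<A> (\<Gamma>_curve c \<xi>) - resolvent \<A> (\<Gamma>_curve c \<eta>)) \<longlongrightarrow> 0) (at \<eta>)"
  proof (rule Lim_null_comparison[OF _ lim])
    have "norm (resolvent \<A> (\<Gamma>_curve c \<xi>) - resolvent \<A> (\<Gamma>_curve c \<eta>))
        \<le> M\<^sub>0 * (cmod (\<Gamma>_curve c \<eta> - \<Gamma>_curve c \<xi>) * M\<^sub>0)" for \<xi>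
      using M
      by (intro order_trans[OF resolvent_lipschitz[OF \<A> \<Gamma>_curve_resolvent_set \<Gamma>_curve_resolvent_set]]
        mult_mono norm_resolvent_\<Gamma>_curve mult_nonneg_nonneg) auto
    then show "\<forall>\<^sub>F \<xi> in at \<eta>. norm (resolvent \<A> (\<Gamma>_curve c \<xi>) - resolvent \<A> (\<Gamma>_curve c \<eta>))
        \<le> M\<^sub>0 * (cmod (\<Gamma>_curve c \<eta> - \<Gamma>_curve c \<xi>) * M\<^sub>0)"
      by simp
  qed
  then show ?thesis by (simp add: isCont_def LIM_zero_cancel)
qed

abbreviation (input) contour_integrand where
  "contour_integrand t \<equiv> (\<lambda>\<eta>. (exp (\<Gamma>_curve c \<eta> * complex_of_real t) * Complex (- c * sgn \<eta>) 1) *\<^sub>C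
    resolvent \<A> (\<Gamma>_curve c \<eta>))"

lemma norm_contour_integrand:
  assumes "0 < r" "r \<le> t"
  shows "norm (contour_integrand t \<eta>) \<le> (c + 1) * M\<^sub>0 * exp (- (c * r) * \<bar>\<eta>\<bar>)"
proof -
  have c: "c > 0" "M\<^sub>0 > 0" using P by (auto simp: condition_P_def)
  have "norm (contour_integrand t \<eta>) = exp (- c * (\<bar>\<eta>\<bar> + 1) * t) *
      cmod (Complex (- c * sgn \<eta>) 1) * norm (resolvent \<A> (\<Gamma>_curve c \<eta>))"
    by (simp add: norm_scaleC norm_mult \<Gamma>_curve_def)
  also have "\<dots> \<le> exp (- (c * r) * \<bar>\<eta>\<bar>) * (c + 1) * M\<^sub>0"
  proof (intro mult_mono norm_resolvent_\<Gamma>_curve)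
    have "c * (\<bar>\<eta>\<bar> * r) \<le> c * ((\<bar>\<eta>\<bar> + 1) * t)"
      using assms c by (intro mult_left_mono mult_mono) auto
    then show "exp (- c * (\<bar>\<eta>\<bar> + 1) * t) \<le> exp (- (c * r) * \<bar>\<eta>\<bar>)"
      by (simp add: algebra_simps)
    show "cmod (Complex (- c * sgn \<eta>) 1) \<le> c + 1"
      using cmod_le[of "Complex (- c * sgn \<eta>) 1"] c by (auto simp: abs_mult sgn_if)
  qed (use c in auto)
  finally show ?thesis by (simp add: mult_ac)
qed

lemma strongly_measurable_contour_integrand: "strongly_measurable lebesgue (contour_integrand t)"
proof (rule strongly_measurable_isCont_compose)
  show "(\<lambda>\<eta>. \<eta>) \<in> borel_measurable (lebesgue :: real measure)"
    by (rule measurable_completion) simp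
  have "isCont (contour_integrand t) \<eta>" if "\<eta> \<noteq> 0" for \<eta>
  proof (intro bounded_bilinear.isCont[OF bounded_bilinear_scaleC] isCont_resolvent_\<Gamma>_curve)
    show "isCont (\<lambda>\<eta>. exp (\<Gamma>_curve c \<eta> * complex_of_real t) * Complex (- c * sgn \<eta>) 1) \<eta>"
      unfolding \<Gamma>_curve_def Complex_eq using that by (intro continuous_intros) auto
  qed
  moreover have "AE \<eta>::real in lebesgue. \<eta> \<noteq> 0"
    by (rule AE_I'[of "{0}"]) auto
  ultimately show "AE \<eta> in lebesgue. isCont (contour_integrand t) \<eta>"
    by (auto elim: eventually_mono)
qed

lemma has_strong_integral_contour_integrand:
  assumes "0 < t"
  shows "has_strong_integral lebesgue (contour_integrand t)
    (strong_integral lebesgue (contour_integrand t))"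
proof (rule has_strong_integral_strong_integral)
  have c: "c > 0" "M\<^sub>0 > 0" using P by (auto simp: condition_P_def)
  have "(\<integral>\<^sup>+\<eta>. norm (contour_integrand t \<eta>) \<partial>lebesgue)
      \<le> (\<integral>\<^sup>+\<eta>. ennreal ((c + 1) * M\<^sub>0) * ennreal (exp (- (c * t) * \<bar>\<eta>\<bar>)) \<partial>lebesgue)"
    using c by (intro nn_integral_mono)
      (simp only: ennreal_mult[symmetric] mult_nonneg_nonneg exp_ge_zero,
       rule ennreal_leI, rule norm_contour_integrand, use assms in auto)
  also have "\<dots> = ennreal ((c + 1) * M\<^sub>0) * (\<integral>\<^sup>+\<eta>. ennreal (exp (- (c * t) * \<bar>\<eta>\<bar>)) \<partial>lebesgue)"
    by (intro nn_integral_cmult measurable_completion) simp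
  also have "\<dots> < \<infinity>"
    using nn_integral_exp_abs_finite[of "c * t"] c assms by (simp add: ennreal_mult_less_top)
  finally show "(\<integral>\<^sup>+\<eta>. norm (contour_integrand t \<eta>) \<partial>lebesgue) < \<infinity>" .
qed (rule complete_measure_lebesgue strongly_measurable_contour_integrand)+

lemma isCont_contour_integral:
  assumes t: "0 < t"
  shows "isCont (\<lambda>t. strong_integral lebesgue (contour_integrand t)) t"
proof (rule continuous_at_sequentiallyI)
  fix X :: "nat \<Rightarrow> real" assume X: "X \<longlonglongrightarrow> t"
  have c: "c > 0" "M\<^sub>0 > 0" using P by (auto simp: condition_P_def)
  define Y where "Y n = max (X n) (t / 2)" for n
  have Yge: "Y n \<ge> t / 2" for n by (simp add: Y_def)
  have Y: "Y \<longlonglongrightarrow> t"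
    using tendsto_max[OF X tendsto_const[of "t / 2"]] t by (simp add: Y_def[abs_def])
  have "\<forall>\<^sub>F n in sequentially. X n > t / 2"
    using X t by (intro order_tendstoD(1)) auto
  then have YX: "\<forall>\<^sub>F n in sequentially. Y n = X n"
    by eventually_elim (simp add: Y_def)
  let ?I = "\<lambda>t. strong_integral lebesgue (contour_integrand t)"
  let ?d = "\<lambda>n \<eta>. ennreal (norm (contour_integrand (Y n) \<eta> - contour_integrand t \<eta>))"
  let ?w = "\<lambda>\<eta>. ennreal (2 * ((c + 1) * M\<^sub>0)) * ennreal (exp (- (c * (t / 2)) * \<bar>\<eta>\<bar>))"
  have "(\<lambda>n. \<integral>\<^sup>+\<eta>. ?d n \<eta> \<partial>lebesgue) \<longlonglongrightarrow> (\<integral>\<^sup>+(\<eta>::real). 0 \<partial>lebesgue)"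
  proof (rule nn_integral_dominated_convergence[where w = ?w])
    show "?d n \<in> borel_measurable lebesgue" for n
      using borel_measurable_norm_strongly_measurable[OF complete_measure_lebesgue
        strongly_measurable_diff[OF strongly_measurable_contour_integrand strongly_measurable_contour_integrand]]
      by simp
    show "?w \<in> borel_measurable lebesgue" by (rule measurable_completion) simp
    have "norm (contour_integrand (Y n) \<eta> - contour_integrand t \<eta>)
        \<le> 2 * ((c + 1) * M\<^sub>0) * exp (- (c * (t / 2)) * \<bar>\<eta>\<bar>)" for n \<eta>
      using norm_triangle_ineq4[of "contour_integrand (Y n) \<eta>" "contour_integrand t \<eta>"]
        norm_contour_integrand[of "t / 2" "Y n" \<eta>] norm_contour_integrand[of "t / 2" t \<eta>] t Yge[of n]
      by simp
    then show "AE \<eta> in lebesgue. ?d n \<eta> \<le> ?w \<eta>" for n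
      using c by (intro AE_I2) (simp only: ennreal_mult[symmetric] mult_nonneg_nonneg exp_ge_zero
        zero_le_numeral add_nonneg_nonneg less_imp_le zero_le_one ennreal_leI)
    have "(\<integral>\<^sup>+\<eta>. ?w \<eta> \<partial>lebesgue) = ennreal (2 * ((c + 1) * M\<^sub>0)) *
        (\<integral>\<^sup>+\<eta>. ennreal (exp (- (c * (t / 2)) * \<bar>\<eta>\<bar>)) \<partial>lebesgue)"
      by (intro nn_integral_cmult measurable_completion) simp
    also have "\<dots> < \<infinity>"
      using nn_integral_exp_abs_finite[of "c * (t / 2)"] c t by (simp add: ennreal_mult_less_top)
    finally show "(\<integral>\<^sup>+\<eta>. ?w \<eta> \<partial>lebesgue) < \<infinity>" .
    have lim: "(\<lambda>n. contour_integrand (Y n) \<eta>) \<longlonglongrightarrow> contour_integrand t \<eta>" for \<eta>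
      by (intro bounded_bilinear.tendsto[OF bounded_bilinear_scaleC] tendsto_intros Y)
    have "(\<lambda>n. ?d n \<eta>) \<longlonglongrightarrow> ennreal (norm (contour_integrand t \<eta> - contour_integrand t \<eta>))" for \<eta>
      by (intro tendsto_ennrealI tendsto_norm tendsto_diff lim tendsto_const)
    then show "AE \<eta> in lebesgue. (\<lambda>n. ?d n \<eta>) \<longlonglongrightarrow> 0" by simp
  qed auto
  then have lim: "(\<lambda>n. \<integral>\<^sup>+\<eta>. ?d n \<eta> \<partial>lebesgue) \<longlonglongrightarrow> 0" by simp
  have le: "ennreal (norm (?I (Y n) - ?I t)) \<le> (\<integral>\<^sup>+\<eta>. ?d n \<eta> \<partial>lebesgue)" for n
    using t Yge[of n]
    by (intro has_strong_integral_dist[OF complete_measure_lebesgue] has_strong_integral_contour_integrand) auto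
  have "(\<lambda>n. ennreal (norm (?I (Y n) - ?I t))) \<longlonglongrightarrow> 0"
    by (rule tendsto_sandwich[OF _ _ tendsto_const lim]) (use le in auto)
  then have "(\<lambda>n. norm (?I (Y n) - ?I t)) \<longlonglongrightarrow> 0"
    using ennreal_tendsto_0_iff[of "\<lambda>n. norm (?I (Y n) - ?I t)"] by simp
  then have "(\<lambda>n. ?I (Y n)) \<longlonglongrightarrow> ?I t"
    by (rule LIM_zero_cancel[OF tendsto_norm_zero_cancel])
  moreover have "\<forall>\<^sub>F n in sequentially. ?I (Y n) = ?I (X n)"
    using YX by eventually_elim simp
  ultimately show "(\<lambda>n. ?I (X n)) \<longlonglongrightarrow> ?I t"
    by (rule Lim_transform_eventually)
qed

lemma isCont_degenerate_semigroup:
  "0 < t \<Longrightarrow> isCont (degenerate_semigroup \<A> c) t"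
  unfolding degenerate_semigroup_def[abs_def]
  by (intro bounded_linear.isCont[OF bounded_linear_scaleC] isCont_contour_integral)

end

section \<open>Almost periodic functions\<close>

definition relatively_dense :: "real set \<Rightarrow> bool"
  where "relatively_dense A \<longleftrightarrow> (\<exists>l>0. \<forall>a. \<exists>\<tau>\<in>{a..a + l}. \<tau> \<in> A)"

lemma relatively_dense_mono: "relatively_dense A \<Longrightarrow> A \<subseteq> B \<Longrightarrow> relatively_dense B"
  unfolding relatively_dense_def by blast

text \<open>Pigeonhole argument: choose \<open>\<alpha> a \<in> A\<close> and \<open>\<gamma> a \<in> B\<close> in each interval \<open>{a..a + l}\<close>.  The
  differences \<open>\<alpha> a - \<gamma> a\<close> lie in \<open>{- l..l}\<close>, so up to \<open>\<delta>\<close> they take only finitely many values.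
  Subtracting a representative of the same class changes \<open>\<alpha> a\<close> by a bounded amount only.\<close>

lemma relatively_dense_common_differences:
  assumes A: "relatively_dense A" and B: "relatively_dense B" and \<delta>: "\<delta> > 0"
  shows "relatively_dense {a - a' | a a'. a \<in> A \<and> a' \<in> A \<and>
    (\<exists>b\<in>B. \<exists>b'\<in>B. \<bar>(a - a') - (b - b')\<bar> \<le> \<delta>)}" (is "relatively_dense ?C")
proof -
  obtain l1 where l1: "l1 > 0" "\<And>a. \<exists>\<tau>\<in>{a..a + l1}. \<tau> \<in> A"
    using A unfolding relatively_dense_def by blast
  obtain l2 where l2: "l2 > 0" "\<And>a. \<exists>\<tau>\<in>{a..a + l2}. \<tau> \<in> B"
    using B unfolding relatively_dense_def by blast
  define l where "l = max l1 l2"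
  obtain \<alpha> where "\<forall>a. \<alpha> a \<in> {a..a + l1} \<and> \<alpha> a \<in> A" using l1(2) by metis
  then have \<alpha>: "a \<le> \<alpha> a" "\<alpha> a \<le> a + l" "\<alpha> a \<in> A" for a
    by (auto simp: l_def intro: order_trans)
  obtain \<gamma> where "\<forall>a. \<gamma> a \<in> {a..a + l2} \<and> \<gamma> a \<in> B" using l2(2) by metis
  then have \<gamma>: "a \<le> \<gamma> a" "\<gamma> a \<le> a + l" "\<gamma> a \<in> B" for a
    by (auto simp: l_def intro: order_trans)
  define j where "j a = \<lfloor>(\<alpha> a - \<gamma> a) / \<delta>\<rfloor>" for a
  have "j a \<in> {\<lfloor>- l / \<delta>\<rfloor>..\<lfloor>l / \<delta>\<rfloor>}" for a
    using \<alpha>(1,2)[of a] \<gamma>(1,2)[of a] \<delta>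
    unfolding j_def atLeastAtMost_iff by (intro conjI floor_mono divide_right_mono) auto
  then have fin: "finite (range j)"
    by (intro finite_subset[of "range j" "{\<lfloor>- l / \<delta>\<rfloor>..\<lfloor>l / \<delta>\<rfloor>}"]) auto
  define r where "r i = (SOME a. j a = i)" for i
  have r: "j (r (j a)) = j a" for a
    unfolding r_def by (rule someI[of "\<lambda>b. j b = j a"]) simp
  define R where "R = (\<Sum>i\<in>range j. \<bar>\<alpha> (r i)\<bar>)"
  have R: "\<bar>\<alpha> (r (j a))\<bar> \<le> R" for a
    unfolding R_def by (rule member_le_sum[OF _ _ fin]) auto
  have "R \<ge> 0" by (simp add: R_def sum_nonneg)
  show ?thesis
    unfolding relatively_dense_def
  proof (intro exI[of _ "l + 2 * R"] conjI allI)
    show "l + 2 * R > 0" using l1(1) \<open>R \<ge> 0\<close> by (simp add: l_def)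
    fix a
    define x where "x = a + R"
    define y where "y = r (j x)"
    have "\<lfloor>(\<alpha> x - \<gamma> x) / \<delta>\<rfloor> = \<lfloor>(\<alpha> y - \<gamma> y) / \<delta>\<rfloor>"
      using r[of x] by (simp add: j_def y_def)
    then have "\<bar>(\<alpha> x - \<gamma> x) / \<delta> - (\<alpha> y - \<gamma> y) / \<delta>\<bar> \<le> 1" by linarith
    then have "\<bar>((\<alpha> x - \<gamma> x) - (\<alpha> y - \<gamma> y)) / \<delta>\<bar> \<le> 1" by (simp add: diff_divide_distrib)
    then have "\<bar>(\<alpha> x - \<alpha> y) - (\<gamma> x - \<gamma> y)\<bar> \<le> \<delta>" using \<delta> by (simp add: abs_divide algebra_simps)
    then have "\<alpha> x - \<alpha> y \<in> ?C" using \<alpha>(3) \<gamma>(3) by blast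
    moreover have "\<alpha> x - \<alpha> y \<in> {a..a + (l + 2 * R)}"
      using \<alpha>(1,2)[of x] R[of x, folded y_def] by (auto simp: x_def)
    ultimately show "\<exists>\<tau>\<in>{a..a + (l + 2 * R)}. \<tau> \<in> ?C" by blast
  qed
qed

lemma almost_periodic_relatively_dense:
  "almost_periodic u \<longleftrightarrow> continuous_on UNIV u \<and>
    (\<forall>\<epsilon>>0. relatively_dense {\<tau>. \<forall>t. norm (u (t + \<tau>) - u t) \<le> \<epsilon>})"
  by (simp add: almost_periodic_def relatively_dense_def)

lemma almost_periodic_isCont: "almost_periodic u \<Longrightarrow> isCont u t"
  by (simp add: almost_periodic_def continuous_on_eq_continuous_at)

lemma almost_periodic_finite_net:
  assumes u: "almost_periodic u" and \<epsilon>: "\<epsilon> > 0"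
  obtains K where "finite K" "\<And>t. \<exists>x\<in>K. norm (u t - x) \<le> \<epsilon>"
proof -
  obtain l where l: "\<And>a. \<exists>\<tau>\<in>{a..a + l}. \<forall>t. norm (u (t + \<tau>) - u t) \<le> \<epsilon> / 2"
    using u \<epsilon> unfolding almost_periodic_def by (meson half_gt_zero)
  have "compact (u ` {0..l})"
    using u by (intro compact_continuous_image) (auto simp: almost_periodic_def intro: continuous_on_subset)
  then obtain K where K: "finite K" "u ` {0..l} \<subseteq> (\<Union>x\<in>K. ball x (\<epsilon> / 2))"
    using \<epsilon> unfolding compact_eq_totally_bounded by (meson half_gt_zero)
  have "\<exists>x\<in>K. norm (u t - x) \<le> \<epsilon>" for t
  proof -
    obtain \<tau> where \<tau>: "\<tau> \<in> {- t..- t + l}" "\<forall>t. norm (u (t + \<tau>) - u t) \<le> \<epsilon> / 2"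
      using l by blast
    then have "u (t + \<tau>) \<in> u ` {0..l}" by auto
    then obtain x where x: "x \<in> K" "dist x (u (t + \<tau>)) < \<epsilon> / 2" using K(2) by auto
    have "norm (u t - x) \<le> norm (u (t + \<tau>) - u t) + norm (x - u (t + \<tau>))"
      using norm_triangle_ineq[of "u (t + \<tau>) - u t" "x - u (t + \<tau>)"] by (simp add: norm_minus_commute)
    then have "norm (u t - x) \<le> \<epsilon>" using x(2) spec[OF \<tau>(2), of t] by (simp add: dist_norm)
    then show ?thesis using x(1) by blast
  qed
  then show ?thesis using K(1) that by blast
qed

lemma almost_periodic_bounded:
  assumes "almost_periodic u"
  obtains B where "B \<ge> 0" "\<And>t. norm (u t) \<le> B"
proof -
  obtain K where K: "finite K" "\<And>t. \<exists>x\<in>K. norm (u t - x) \<le> 1"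
    using almost_periodic_finite_net[OF assms zero_less_one] by metis
  have "norm (u t) \<le> (\<Sum>x\<in>K. norm x) + 1" for t
  proof -
    obtain x where x: "x \<in> K" "norm (u t - x) \<le> 1" using K(2) by blast
    have "norm x \<le> (\<Sum>x\<in>K. norm x)" using x(1) K(1) by (intro member_le_sum) auto
    then show ?thesis using x(2) norm_triangle_sub[of "u t" x] by simp
  qed
  then show ?thesis by (intro that[of "(\<Sum>x\<in>K. norm x) + 1"] add_nonneg_nonneg sum_nonneg) auto
qed

lemma almost_periodic_uniformly_continuous:
  assumes u: "almost_periodic u" and \<epsilon>: "\<epsilon> > 0"
  obtains \<delta> where "\<delta> > 0" "\<And>t h. \<bar>h\<bar> \<le> \<delta> \<Longrightarrow> norm (u (t + h) - u t) \<le> \<epsilon>"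
proof -
  have "\<epsilon> / 3 > 0" using \<epsilon> by simp
  then obtain l where l: "\<And>a. \<exists>\<tau>\<in>{a..a + l}. \<forall>t. norm (u (t + \<tau>) - u t) \<le> \<epsilon> / 3"
    using u unfolding almost_periodic_def by meson
  have "uniformly_continuous_on {- 1..l + 1} u"
    using u by (intro compact_uniformly_continuous) (auto simp: almost_periodic_def intro: continuous_on_subset)
  then obtain d where d: "d > 0"
    "\<And>x y. x \<in> {- 1..l + 1} \<Longrightarrow> y \<in> {- 1..l + 1} \<Longrightarrow> dist y x < d \<Longrightarrow> dist (u y) (u x) < \<epsilon> / 3"
    unfolding uniformly_continuous_on_def using \<open>\<epsilon> / 3 > 0\<close> by metis
  show ?thesis
  proof
    show "min (d / 2) 1 > 0" using d(1) by simp
    fix t h :: real assume h: "\<bar>h\<bar> \<le> min (d / 2) 1"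
    obtain \<tau> where \<tau>: "\<tau> \<in> {- t..- t + l}" "\<And>t. norm (u (t + \<tau>) - u t) \<le> \<epsilon> / 3"
      using l by blast
    have "dist (u (t + h + \<tau>)) (u (t + \<tau>)) < \<epsilon> / 3"
      using h \<tau>(1) d(1) by (intro d(2)) (auto simp: dist_real_def)
    moreover have "norm (u (t + h) - u t) \<le> norm (u (t + h + \<tau>) - u (t + h))
        + norm (u (t + h + \<tau>) - u (t + \<tau>)) + norm (u (t + \<tau>) - u t)"
      using norm_triangle_ineq[of "u (t + h + \<tau>) - u (t + \<tau>)" "u (t + \<tau>) - u t"]
        norm_triangle_ineq4[of "u (t + h + \<tau>) - u t" "u (t + h + \<tau>) - u (t + h)"] by simp
    ultimately show "norm (u (t + h) - u t) \<le> \<epsilon>"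
      using \<tau>(2)[of t] \<tau>(2)[of "t + h"] by (simp add: dist_norm)
  qed
qed

lemma almost_periodic_uniform_limit:
  assumes u: "continuous_on UNIV u"
    and approx: "\<And>\<epsilon>. \<epsilon> > 0 \<Longrightarrow> \<exists>v. almost_periodic v \<and> (\<forall>t. norm (u t - v t) \<le> \<epsilon>)"
  shows "almost_periodic u"
  unfolding almost_periodic_relatively_dense
proof (intro conjI allI impI u)
  fix \<epsilon> :: real assume "\<epsilon> > 0"
  then have \<epsilon>: "\<epsilon> / 3 > 0" by simp
  obtain v where v: "almost_periodic v" "\<And>t. norm (u t - v t) \<le> \<epsilon> / 3"
    using approx[OF \<epsilon>] by blast
  have "relatively_dense {\<tau>. \<forall>t. norm (v (t + \<tau>) - v t) \<le> \<epsilon> / 3}"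
    using v(1) \<epsilon> unfolding almost_periodic_relatively_dense by blast
  then show "relatively_dense {\<tau>. \<forall>t. norm (u (t + \<tau>) - u t) \<le> \<epsilon>}"
  proof (rule relatively_dense_mono, safe)
    fix \<tau> t assume "\<forall>t. norm (v (t + \<tau>) - v t) \<le> \<epsilon> / 3"
    then have "norm (v (t + \<tau>) - v t) \<le> \<epsilon> / 3" by blast
    moreover have "norm (u (t + \<tau>) - u t) \<le>
        norm (u (t + \<tau>) - v (t + \<tau>)) + norm (v (t + \<tau>) - v t) + norm (u t - v t)"
      using norm_triangle_ineq[of "u (t + \<tau>) - v (t + \<tau>)" "v (t + \<tau>) - v t"]
        norm_triangle_ineq4[of "u (t + \<tau>) - v t" "u t - v t"] by simp
    ultimately show "norm (u (t + \<tau>) - u t) \<le> \<epsilon>"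
      using v(2)[of t] v(2)[of "t + \<tau>"] by simp
  qed
qed

lemma almost_periodic_zero: "almost_periodic (\<lambda>_. 0)"
proof -
  have "\<exists>l>0. \<forall>a::real. \<exists>\<tau>. \<tau> \<in> {a..a + l}"
    by (intro exI[of _ 1] conjI allI exI[of _ a for a]) auto
  then show ?thesis by (auto simp: almost_periodic_def)
qed

section \<open>Convolution with a summable kernel\<close>

lemma strongly_measurable_restrict_space:
  assumes g: "strongly_measurable N g" and S: "S \<in> sets N"
  shows "strongly_measurable (restrict_space N S) g"
proof -
  obtain s where s: "\<And>i. simple_function N (s i)" "AE x in N. (\<lambda>i. s i x) \<longlonglongrightarrow> g x"
    using g unfolding strongly_measurable_def by blast
  have SN: "S \<subseteq> space N" using S by (rule sets.sets_into_space)
  have "simple_function (restrict_space N S) (s i)" for i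
  proof -
    have "finite (s i ` S)"
      by (rule finite_subset[OF image_mono[OF SN] simple_functionD(1)[OF s(1)]])
    moreover have "s i -` {x} \<inter> S \<in> sets (restrict_space N S)" for x
    proof -
      have "(s i -` {x} \<inter> space N) \<inter> S \<in> sets N"
        by (rule sets.Int[OF simple_functionD(2)[OF s(1)] S])
      moreover have "(s i -` {x} \<inter> space N) \<inter> S = s i -` {x} \<inter> S" using SN by auto
      ultimately show ?thesis using S SN by (simp add: sets_restrict_space_iff Int_absorb2)
    qed
    ultimately show ?thesis
      using SN by (simp add: simple_function_def space_restrict_space Int_absorb2)
  qed
  moreover have "AE x in restrict_space N S. (\<lambda>i. s i x) \<longlonglongrightarrow> g x"
    using s(2) S by (auto simp: AE_restrict_space_iff elim: eventually_mono)
  ultimately show ?thesis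
    unfolding strongly_measurable_def by (intro exI[of _ s]) blast
qed

lemma strongly_measurable_indicator:
  assumes g: "strongly_measurable (restrict_space N S) g" and S: "S \<in> sets N"
  shows "strongly_measurable N (\<lambda>x. indicat_real S x *\<^sub>R g x)"
proof -
  obtain s where s: "\<And>i. simple_function (restrict_space N S) (s i)"
    "AE x in restrict_space N S. (\<lambda>i. s i x) \<longlonglongrightarrow> g x"
    using g unfolding strongly_measurable_def by blast
  have SN: "S \<subseteq> space N" using S by (rule sets.sets_into_space)
  have "simple_function N (\<lambda>x. if x \<in> S then s i x else 0)" for i
    unfolding simple_function_def
  proof (intro conjI ballI)
    have "finite (s i ` S)"
      using simple_functionD(1)[OF s(1)[of i]] SN by (simp add: space_restrict_space Int_absorb2)
    then have "finite (insert 0 (s i ` S))" by simp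
    then show "finite ((\<lambda>x. if x \<in> S then s i x else 0) ` space N)"
      by (rule finite_subset[rotated]) auto
    fix y
    have "s i -` {y} \<inter> S \<in> sets N"
      using simple_functionD(2)[OF s(1)[of i], of "{y}"] S SN
      by (simp add: sets_restrict_space_iff space_restrict_space Int_absorb2)
    moreover have "(\<lambda>x. if x \<in> S then s i x else 0) -` {y} \<inter> space N
        = (s i -` {y} \<inter> S) \<union> (if y = 0 then space N - S else {})"
      using SN by (auto split: if_splits)
    ultimately show "(\<lambda>x. if x \<in> S then s i x else 0) -` {y} \<inter> space N \<in> sets N"
      using S by auto
  qed
  moreover have "AE x in N. (\<lambda>i. if x \<in> S then s i x else 0) \<longlonglongrightarrow> indicat_real S x *\<^sub>R g x"
    using s(2) S unfolding AE_restrict_space_iff[OF sets.Int[OF S sets.top]]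
    by (auto elim!: eventually_mono simp: indicator_def)
  ultimately show ?thesis
    unfolding strongly_measurable_def by (intro exI[of _ "\<lambda>i x. if x \<in> S then s i x else 0"]) blast
qed

lemma strongly_measurable_countable_cover:
  fixes S :: "nat \<Rightarrow> 'a set"
  assumes S: "\<And>i. S i \<in> sets N" "space N \<subseteq> (\<Union>i. S i)"
    and g: "\<And>i. strongly_measurable (restrict_space N (S i)) g"
  shows "strongly_measurable N g"
proof -
  define U where "U n = (\<Union>i<n. S i)" for n
  have U: "U n \<in> sets N" for n using S(1) by (auto simp: U_def)
  have ind: "strongly_measurable N (\<lambda>x. indicat_real A x *\<^sub>R h x)"
    if "strongly_measurable N h" "A \<in> sets N" for h :: "'a \<Rightarrow> 'b" and A
    using strongly_measurable_compose2[OF strongly_measurable_simple_function[OF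
      simple_function_indicator[OF that(2)]] that(1) tendsto_scaleR] .
  have sm: "strongly_measurable N (\<lambda>x. indicat_real (U n) x *\<^sub>R g x)" for n
  proof (induction n)
    case 0
    then show ?case by (simp add: U_def strongly_measurable_const)
  next
    case (Suc n)
    have "strongly_measurable N (\<lambda>x. indicat_real (S n) x *\<^sub>R g x
        + indicat_real (U n - S n) x *\<^sub>R (indicat_real (U n) x *\<^sub>R g x))"
      using U S(1) by (intro strongly_measurable_add ind[OF Suc] strongly_measurable_indicator[OF g]) auto
    also have "(\<lambda>x. indicat_real (S n) x *\<^sub>R g x
        + indicat_real (U n - S n) x *\<^sub>R (indicat_real (U n) x *\<^sub>R g x))
        = (\<lambda>x. indicat_real (U (Suc n)) x *\<^sub>R g x)"
      by (auto simp: fun_eq_iff U_def indicator_def less_Suc_eq)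
    finally show ?case .
  qed
  have lim: "(\<lambda>n. indicat_real (U n) x *\<^sub>R g x) \<longlonglongrightarrow> g x" if x: "x \<in> space N" for x
  proof (rule tendsto_eventually)
    obtain i where i: "x \<in> S i" using S(2) x by blast
    show "\<forall>\<^sub>F n in sequentially. indicat_real (U n) x *\<^sub>R g x = g x"
      using eventually_gt_at_top[of i] by eventually_elim (use i in \<open>auto simp: U_def indicator_def\<close>)
  qed
  show ?thesis
    by (rule strongly_measurable_LIMSEQ[OF sm AE_I2[OF lim]])
qed

lemma strongly_measurable_reflect:
  "strongly_measurable lebesgue g \<Longrightarrow> strongly_measurable lebesgue (\<lambda>r::real. g (t - r))"
  using strongly_measurable_compose_distr[of lebesgue lebesgue "\<lambda>r. t - r" g]
  by (simp add: distr_lebesgue_reflect lebesgue_reflect_measurable)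

lemma strongly_measurable_shift:
  "strongly_measurable lebesgue g \<Longrightarrow> strongly_measurable lebesgue (\<lambda>r::real. g (r + h))"
  using strongly_measurable_compose_distr[of lebesgue lebesgue "\<lambda>r. h + r" g]
  unfolding distr_lebesgue_shift by (simp add: lebesgue_shift_measurable add.commute[of _ h])

definition weighted_norm ::
    "(real \<Rightarrow> 'a::real_normed_vector) \<Rightarrow> (real \<Rightarrow> 'b::real_normed_vector) \<Rightarrow> real \<Rightarrow> ennreal"
  where "weighted_norm T g t = (\<integral>\<^sup>+r. ennreal (norm (T r) * norm (g (t - r))) \<partial>lebesgue_on {0<..})"

locale summable_kernel =
  fixes T :: "real \<Rightarrow> 'k::real_normed_vector" and p M :: real and q :: ereal
  assumes isCont_T: "\<And>t. 0 < t \<Longrightarrow> isCont T t"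
    and p: "1 \<le> p" and q: "q = (if p = 1 then \<infinity> else ereal (p / (p - 1)))"
    and M: "0 \<le> M"
    and sum_T: "(\<Sum>k. Lq_norm q (lebesgue_on {real k..real k + 1}) (\<lambda>t. norm (T t))) = ennreal M"
begin

abbreviation "T_norm k \<equiv> Lq_norm q (lebesgue_on {real k..real k + 1}) (\<lambda>t. norm (T t))"

lemma T_norm_finite: "T_norm k < \<infinity>"
  using ennreal_suminf_lessD[of T_norm \<infinity> k] by (simp add: sum_T)

lemma strongly_measurable_T:
  assumes "S \<in> sets lebesgue" "S \<subseteq> {0..}"
  shows "strongly_measurable (lebesgue_on S) T"
proof (rule strongly_measurable_isCont_compose)
  show "(\<lambda>r. r) \<in> borel_measurable (lebesgue_on S)"
    by (intro measurable_restrict_space1 measurable_completion) simp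
  have "AE r::real in lebesgue. r \<noteq> 0"
    by (rule AE_I'[of "{0}"]) auto
  then have "AE r in lebesgue. r \<in> S \<longrightarrow> isCont T r"
    by eventually_elim (use assms(2) isCont_T in force)
  then show "AE r in lebesgue_on S. isCont T r"
    using assms(1) by (simp add: AE_restrict_space_iff)
qed

lemma borel_measurable_weight:
  assumes "S \<in> sets lebesgue" "S \<subseteq> {0..}"
  shows "(\<lambda>r. norm (T r)) \<in> borel_measurable (lebesgue_on S)"
  using assms
  by (intro borel_measurable_norm_strongly_measurable complete_measure_lebesgue_on strongly_measurable_T)

lemma borel_measurable_reflect:
  assumes "strongly_measurable lebesgue g" "S \<in> sets lebesgue"
  shows "(\<lambda>r::real. norm (g (t - r))) \<in> borel_measurable (lebesgue_on S)"
  using assms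
  by (intro borel_measurable_norm_strongly_measurable complete_measure_lebesgue_on
    strongly_measurable_restrict_space strongly_measurable_reflect[OF assms(1)])

lemma weighted_norm_le_suminf:
  assumes g: "strongly_measurable lebesgue g"
  shows "weighted_norm T g t
    \<le> (\<Sum>k. \<integral>\<^sup>+r. ennreal (norm (T r) * norm (g (t - r))) \<partial>lebesgue_on {real k..real k + 1})"
proof -
  let ?G = "\<lambda>r. ennreal (norm (T r) * norm (g (t - r)))"
  have m: "(\<lambda>r. ?G r * indicator {real k..real k + 1} r) \<in> borel_measurable lebesgue" for k
  proof -
    have "?G \<in> borel_measurable (lebesgue_on {real k..real k + 1})"
      using borel_measurable_weight[of "{real k..real k + 1}"]
        borel_measurable_reflect[OF g, of "{real k..real k + 1}" t] by auto
    then show ?thesis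
      by (subst borel_measurable_restrict_space_iff_ennreal[symmetric]) auto
  qed
  have "weighted_norm T g t = (\<integral>\<^sup>+r. ?G r * indicator {0<..} r \<partial>lebesgue)"
    unfolding weighted_norm_def by (rule nn_integral_restrict_space) simp
  also have "\<dots> \<le> (\<integral>\<^sup>+r. (\<Sum>k. ?G r * indicator {real k..real k + 1} r) \<partial>lebesgue)"
  proof (rule nn_integral_mono)
    fix r :: real
    show "?G r * indicator {0<..} r \<le> (\<Sum>k. ?G r * indicator {real k..real k + 1} r)"
    proof (cases "r > 0")
      case True
      define k where "k = nat \<lfloor>r\<rfloor>"
      have "r \<in> {real k..real k + 1}"
        using True by (auto simp: k_def)
      then have "?G r * indicator {0<..} r = (\<Sum>j\<in>{k}. ?G r * indicator {real j..real j + 1} r)"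
        using True by simp
      also have "\<dots> \<le> (\<Sum>k. ?G r * indicator {real k..real k + 1} r)"
        by (rule sum_le_suminf) auto
      finally show ?thesis .
    qed simp
  qed
  also have "\<dots> = (\<Sum>k. \<integral>\<^sup>+r. ?G r * indicator {real k..real k + 1} r \<partial>lebesgue)"
    by (rule nn_integral_suminf[OF m])
  also have "\<dots> = (\<Sum>k. \<integral>\<^sup>+r. ?G r \<partial>lebesgue_on {real k..real k + 1})"
    by (simp add: nn_integral_restrict_space)
  finally show ?thesis .
qed

lemma nn_integral_weight_piece:
  assumes g: "strongly_measurable lebesgue g"
    and fin: "Stepanov_norm p (\<lambda>s. g (t - (real k + 1) + s)) < \<infinity>"
  shows "(\<integral>\<^sup>+r. ennreal (norm (T r) * norm (g (t - r))) \<partial>lebesgue_on {real k..real k + 1})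
    \<le> T_norm k * Stepanov_norm p (\<lambda>s. g (t - (real k + 1) + s))"
proof -
  let ?N = "lebesgue_on {real k..real k + 1}"
  note r = measurable_restrict_vimage[OF lebesgue_reflect_measurable distr_lebesgue_reflect,
      of "{0..1}" "real k + 1" "{real k..real k + 1}"]
  have m: "(\<lambda>s. real k + 1 - s) \<in> measurable ?N (lebesgue_on {0..1})"
    "distr ?N (lebesgue_on {0..1}) (\<lambda>s. real k + 1 - s) = lebesgue_on {0..1}"
    by (rule r; auto)+
  have gs: "strongly_measurable lebesgue (\<lambda>s. g (t - (real k + 1) + s))"
    unfolding add.commute[of "t - (real k + 1)"] by (rule strongly_measurable_shift[OF g])
  have "(\<lambda>s. norm (g (t - (real k + 1) + s))) \<in> borel_measurable (lebesgue_on {0..1})"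
    by (intro borel_measurable_norm_strongly_measurable complete_measure_lebesgue_on
        strongly_measurable_restrict_space gs) auto
  from Lq_norm_distr[OF m(1) this, of p]
  have eq: "Stepanov_norm p (\<lambda>s. g (t - (real k + 1) + s)) = Lq_norm (ereal p) ?N (\<lambda>r. g (t - r))"
    by (simp add: m(2))
  have "(\<integral>\<^sup>+r. ennreal (norm (norm (T r)) * norm (g (t - r))) \<partial>?N)
      \<le> T_norm k * Lq_norm (ereal p) ?N (\<lambda>r. g (t - r))"
  proof (rule nn_integral_Hoelder[OF p q])
    show "Lq_norm (ereal p) ?N (\<lambda>r. g (t - r)) < \<infinity>" using fin by (simp only: eq)
  qed (use T_norm_finite borel_measurable_weight[of "{real k..real k + 1}"]
      borel_measurable_reflect[OF g, of "{real k..real k + 1}" t] in auto)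
  then show ?thesis by (simp add: eq)
qed

lemma weighted_norm_le:
  assumes g: "strongly_measurable lebesgue g" and e: "\<And>a. Stepanov_norm p (\<lambda>s. g (a + s)) \<le> ennreal e"
  shows "weighted_norm T g t \<le> ennreal M * ennreal e"
proof -
  have "weighted_norm T g t
      \<le> (\<Sum>k. \<integral>\<^sup>+r. ennreal (norm (T r) * norm (g (t - r))) \<partial>lebesgue_on {real k..real k + 1})"
    by (rule weighted_norm_le_suminf[OF g])
  also have "\<dots> \<le> (\<Sum>k. T_norm k * ennreal e)"
  proof (rule suminf_le[OF _ summableI summableI])
    fix k
    have "(\<integral>\<^sup>+r. ennreal (norm (T r) * norm (g (t - r))) \<partial>lebesgue_on {real k..real k + 1})
        \<le> T_norm k * Stepanov_norm p (\<lambda>s. g (t - (real k + 1) + s))"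
      by (rule nn_integral_weight_piece[OF g]) (rule order.strict_trans1[OF e], simp)
    also have "\<dots> \<le> T_norm k * ennreal e" by (intro mult_left_mono e) simp
    finally show "(\<integral>\<^sup>+r. ennreal (norm (T r) * norm (g (t - r))) \<partial>lebesgue_on {real k..real k + 1})
        \<le> T_norm k * ennreal e" .
  qed
  also have "\<dots> = ennreal M * ennreal e" by (simp add: sum_T)
  finally show ?thesis .
qed

lemma weighted_norm_const_le: "weighted_norm T (\<lambda>_. C :: real) t \<le> ennreal M * ennreal \<bar>C\<bar>"
proof (rule weighted_norm_le[OF strongly_measurable_const])
  have "emeasure (lebesgue_on {0..1::real}) (space (lebesgue_on {0..1})) = 1"
    by (simp add: emeasure_restrict_space)
  then show "Stepanov_norm p (\<lambda>s. C) \<le> ennreal \<bar>C\<bar>"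
    by (rule Lq_norm_const_le[OF p]) simp
qed

lemma weighted_norm_sum_le:
  assumes I: "finite I" and h: "\<And>i. i \<in> I \<Longrightarrow> strongly_measurable lebesgue (h i)" and C: "C \<ge> 0"
    and le: "\<And>s. norm (g s) \<le> C + (\<Sum>i\<in>I. norm (h i s))"
  shows "weighted_norm T g t \<le> ennreal (M * C) + (\<Sum>i\<in>I. weighted_norm T (h i) t)"
proof -
  let ?N = "lebesgue_on {0::real<..}"
  have [measurable]: "(\<lambda>r. norm (T r)) \<in> borel_measurable ?N"
    by (rule borel_measurable_weight) auto
  have [measurable]: "(\<lambda>r. norm (h i (t - r))) \<in> borel_measurable ?N" if "i \<in> I" for i
    by (rule borel_measurable_reflect[OF h[OF that]]) simp
  have "weighted_norm T g t \<le> (\<integral>\<^sup>+r. ennreal (norm (T r) * norm C)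
      + (\<Sum>i\<in>I. ennreal (norm (T r) * norm (h i (t - r)))) \<partial>?N)"
    unfolding weighted_norm_def
  proof (rule nn_integral_mono)
    fix r
    have "norm (T r) * norm (g (t - r)) \<le> norm (T r) * (C + (\<Sum>i\<in>I. norm (h i (t - r))))"
      by (intro mult_left_mono le) simp
    also have "\<dots> = norm (T r) * norm C + (\<Sum>i\<in>I. norm (T r) * norm (h i (t - r)))"
      using C by (simp add: distrib_left sum_distrib_left)
    finally have "ennreal (norm (T r) * norm (g (t - r)))
        \<le> ennreal (norm (T r) * norm C + (\<Sum>i\<in>I. norm (T r) * norm (h i (t - r))))"
      by (rule ennreal_leI)
    then show "ennreal (norm (T r) * norm (g (t - r))) \<le> ennreal (norm (T r) * norm C)
        + (\<Sum>i\<in>I. ennreal (norm (T r) * norm (h i (t - r))))"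
      by (simp add: ennreal_plus sum_nonneg sum_ennreal)
  qed
  also have "\<dots> = (\<integral>\<^sup>+r. ennreal (norm (T r) * norm C) \<partial>?N)
      + (\<integral>\<^sup>+r. (\<Sum>i\<in>I. ennreal (norm (T r) * norm (h i (t - r)))) \<partial>?N)"
    by (rule nn_integral_add) auto
  also have "(\<integral>\<^sup>+r. (\<Sum>i\<in>I. ennreal (norm (T r) * norm (h i (t - r)))) \<partial>?N)
      = (\<Sum>i\<in>I. weighted_norm T (h i) t)"
    unfolding weighted_norm_def by (rule nn_integral_sum) auto
  also have "(\<integral>\<^sup>+r. ennreal (norm (T r) * norm C) \<partial>?N) + (\<Sum>i\<in>I. weighted_norm T (h i) t)
      \<le> ennreal (M * C) + (\<Sum>i\<in>I. weighted_norm T (h i) t)"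
    using weighted_norm_const_le[of C t] C M
    by (intro add_right_mono) (simp add: weighted_norm_def ennreal_mult)
  finally show ?thesis .
qed

lemma weighted_norm_triangle:
  fixes g h :: "real \<Rightarrow> 'b::real_normed_vector"
  assumes "strongly_measurable lebesgue g" "strongly_measurable lebesgue h"
    and "\<And>s. norm (k s) \<le> norm (g s) + norm (h s)"
  shows "weighted_norm T k t \<le> weighted_norm T g t + weighted_norm T h t"
proof -
  have "weighted_norm T k t
      \<le> ennreal (M * 0) + (\<Sum>b\<in>{True, False}. weighted_norm T (if b then g else h) t)"
    by (rule weighted_norm_sum_le) (use assms in auto)
  then show ?thesis by simp
qed

end

section \<open>The fixed point argument\<close>

lemma lipschitz_isCont:
  fixes f :: "'a::real_normed_vector \<Rightarrow> 'b::real_normed_vector"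
  assumes "\<And>x y. norm (f x - f y) \<le> L * norm (x - y)"
  shows "isCont f x"
proof -
  have "((\<lambda>y. L * norm (y - x)) \<longlongrightarrow> L * norm (x - x)) (at x)"
    by (intro tendsto_intros)
  then have lim: "((\<lambda>y. L * norm (y - x)) \<longlongrightarrow> 0) (at x)" by simp
  have "((\<lambda>y. f y - f x) \<longlongrightarrow> 0) (at x)"
    by (rule Lim_null_comparison[OF _ lim]) (use assms in simp)
  then show ?thesis by (simp add: isCont_def LIM_zero_cancel)
qed

locale mild_problem = summable_kernel T p M q
  for T :: "real \<Rightarrow> 'a::banach \<Rightarrow>\<^sub>L 'a" and p M :: real and q :: ereal +
  fixes f :: "real \<Rightarrow> 'a \<Rightarrow> 'a" and L :: real
  assumes f: "f \<in> APS p" and L: "0 < L"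
    and lipschitz: "\<And>t x y. norm (f t x - f t y) \<le> L * norm (x - y)"
begin

lemma strongly_measurable_f: "strongly_measurable lebesgue (\<lambda>s. f s x)"
proof (rule strongly_measurable_countable_cover)
  let ?a = "\<lambda>n::nat. real_of_int (from_nat n)"
  show "{?a n..?a n + 1} \<in> sets lebesgue" for n by simp
  have "s \<in> {?a (to_nat \<lfloor>s\<rfloor>)..?a (to_nat \<lfloor>s\<rfloor>) + 1}" for s
    using of_int_floor_le[of s] real_of_int_floor_add_one_ge[of s] by simp
  then show "space lebesgue \<subseteq> (\<Union>n. {?a n..?a n + 1})" by blast
  show "strongly_measurable (lebesgue_on {?a n..?a n + 1}) (\<lambda>s. f s x)" for n
  proof -
    let ?\<phi> = "\<lambda>s. - ?a n + s"
    note r = measurable_restrict_vimage[OF lebesgue_shift_measurable distr_lebesgue_shift,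
        of "{0..1}" "- ?a n" "{?a n..?a n + 1}"]
    have m: "?\<phi> \<in> measurable (lebesgue_on {?a n..?a n + 1}) (lebesgue_on {0..1})"
      "distr (lebesgue_on {?a n..?a n + 1}) (lebesgue_on {0..1}) ?\<phi> = lebesgue_on {0..1}"
      by (rule r; auto)+
    have "strongly_measurable (lebesgue_on {0..1}) (\<lambda>s. f (?a n + s) x)"
      using f by (auto simp: APS_def Lp_space_def f_hat_def)
    then have "strongly_measurable (lebesgue_on {?a n..?a n + 1}) (\<lambda>s. f (?a n + ?\<phi> s) x)"
      by (intro strongly_measurable_compose_distr[OF _ m(1)]) (simp only: m(2))
    then show ?thesis by simp
  qed
qed

lemma strongly_measurable_f_shift: "strongly_measurable lebesgue (\<lambda>s. f (s + h) x - f s x)"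
  by (intro strongly_measurable_diff strongly_measurable_f
    strongly_measurable_shift[where g = "\<lambda>s. f s x"])

lemma f_bound:
  obtains B where "B \<ge> 0" "\<And>a x. Stepanov_norm p (\<lambda>s. f (a + s) x) \<le> ennreal B"
proof -
  obtain B where B: "\<And>z. Stepanov_norm p (f_hat f z) \<le> ennreal B"
    using f by (auto simp: APS_def)
  have "Stepanov_norm p (\<lambda>s. f (a + s) x) \<le> ennreal (max 0 B)" for a x
    using order_trans[OF B[of "(a, x)"] ennreal_leI[of B "max 0 B"]] by (simp add: f_hat_def)
  then show ?thesis by (intro that[of "max 0 B"]) auto
qed

lemma Stepanov_norm_shift_tendsto:
  assumes X: "X \<longlonglongrightarrow> 0"
  shows "(\<lambda>n. Stepanov_norm p (\<lambda>s. f (a + X n + s) x - f (a + s) x)) \<longlonglongrightarrow> 0"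
proof -
  let ?N = "\<lambda>w. Stepanov_norm p (\<lambda>s. f_hat f w s - f_hat f (a, x) s)"
  have 0: "?N (a, x) = 0" using p by (simp add: Lq_norm_zero)
  have N: "(?N \<longlongrightarrow> ?N (a, x)) (at (a, x))"
    unfolding 0 using f unfolding APS_def by blast
  have "(?N \<longlongrightarrow> 0) (nhds (a, x))"
    using N[unfolded tendsto_at_iff_tendsto_nhds[of ?N "(a, x)"]] by (simp only: 0)
  moreover have "(\<lambda>n. (a + X n, x)) \<longlonglongrightarrow> (a + 0, x)"
    by (intro tendsto_intros X)
  then have "(\<lambda>n. (a + X n, x)) \<longlonglongrightarrow> (a, x)" by simp
  ultimately have "(\<lambda>n. ?N (a + X n, x)) \<longlonglongrightarrow> 0"
    by (rule filterlim_compose)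
  then show ?thesis by (simp add: f_hat_def)
qed

text \<open>Each unit interval contributes a term tending to \<open>0\<close>, and the \<open>k\<close>-th term is dominated by
  \<open>2 B T_norm k\<close>, so the series can be passed to the limit.\<close>

lemma weighted_norm_shift_tendsto:
  assumes X: "X \<longlonglongrightarrow> 0"
  shows "(\<lambda>n. weighted_norm T (\<lambda>s. f (s + X n) x - f s x) t) \<longlonglongrightarrow> 0"
proof -
  obtain B where B: "B \<ge> 0" "\<And>a x. Stepanov_norm p (\<lambda>s. f (a + s) x) \<le> ennreal B"
    using f_bound by metis
  let ?g = "\<lambda>n s. f (s + X n) x - f s x"
  let ?J = "\<lambda>g k. \<integral>\<^sup>+r. ennreal (norm (T r) * norm (g (t - r))) \<partial>lebesgue_on {real k..real k + 1}"
  let ?S = "\<lambda>k n. Stepanov_norm p (\<lambda>s. ?g n (t - (real k + 1) + s))"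
  have sm: "strongly_measurable lebesgue (\<lambda>s. f (s + h) x)" for h
    by (rule strongly_measurable_shift[OF strongly_measurable_f])
  have piece: "?J (\<lambda>s. f (s + h) x) k \<le> T_norm k * ennreal B" for h k
  proof -
    have le: "Stepanov_norm p (\<lambda>s. f (t - (real k + 1) + s + h) x) \<le> ennreal B"
      using B(2)[of "t - (real k + 1) + h" x] by (simp only: add.assoc add.commute[of h])
    have "?J (\<lambda>s. f (s + h) x) k
        \<le> T_norm k * Stepanov_norm p (\<lambda>s. f (t - (real k + 1) + s + h) x)"
      by (rule nn_integral_weight_piece[OF sm]) (rule order.strict_trans1[OF le], simp)
    also have "\<dots> \<le> T_norm k * ennreal B" by (intro mult_left_mono le) simp
    finally show ?thesis .
  qed
  have S: "?S k \<longlonglongrightarrow> 0" for k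
    using Stepanov_norm_shift_tendsto[OF X, of "t - (real k + 1)" x]
    unfolding add.assoc add.commute[of "X n" for n] .
  have J: "(\<lambda>n. ?J (?g n) k) \<longlonglongrightarrow> 0" for k
  proof (rule tendsto_sandwich[OF _ _ tendsto_const])
    have "\<forall>\<^sub>F n in sequentially. ?S k n < \<infinity>"
      using S[of k] by (rule order_tendstoD) simp
    then show "\<forall>\<^sub>F n in sequentially. ?J (?g n) k \<le> T_norm k * ?S k n"
      by eventually_elim (rule nn_integral_weight_piece[OF strongly_measurable_f_shift])
    show "(\<lambda>n. T_norm k * ?S k n) \<longlonglongrightarrow> 0"
      using ennreal_tendsto_cmult[OF T_norm_finite[of k, unfolded infinity_ennreal_def] S[of k]] by simp
  qed simp
  have dom: "?J (?g n) k \<le> T_norm k * ennreal B + T_norm k * ennreal B" for n k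
  proof -
    let ?N = "lebesgue_on {real k..real k + 1}"
    have [measurable]: "(\<lambda>r. norm (T r)) \<in> borel_measurable ?N"
      by (rule borel_measurable_weight) auto
    have [measurable]: "(\<lambda>r. norm (f (t - r + h) x)) \<in> borel_measurable ?N" for h
      by (rule borel_measurable_reflect[OF sm]) simp
    note [measurable] = this[of 0, simplified]
    have "?J (?g n) k \<le> (\<integral>\<^sup>+r. ennreal (norm (T r) * norm (f (t - r + X n) x))
        + ennreal (norm (T r) * norm (f (t - r + 0) x)) \<partial>?N)"
    proof (rule nn_integral_mono)
      fix r
      have "norm (T r) * norm (?g n (t - r))
          \<le> norm (T r) * (norm (f (t - r + X n) x) + norm (f (t - r + 0) x))"
        by (intro mult_left_mono) (simp_all add: norm_triangle_ineq4)
      then have "ennreal (norm (T r) * norm (?g n (t - r)))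
          \<le> ennreal (norm (T r) * norm (f (t - r + X n) x) + norm (T r) * norm (f (t - r + 0) x))"
        unfolding distrib_left by (rule ennreal_leI)
      also have "\<dots> = ennreal (norm (T r) * norm (f (t - r + X n) x))
          + ennreal (norm (T r) * norm (f (t - r + 0) x))"
        by (rule ennreal_plus) auto
      finally show "ennreal (norm (T r) * norm (?g n (t - r))) \<le> ennreal (norm (T r) * norm (f (t - r + X n) x))
          + ennreal (norm (T r) * norm (f (t - r + 0) x))" .
    qed
    also have "\<dots> = ?J (\<lambda>s. f (s + X n) x) k + ?J (\<lambda>s. f (s + 0) x) k"
      by (rule nn_integral_add) auto
    also have "\<dots> \<le> T_norm k * ennreal B + T_norm k * ennreal B"
      by (intro add_mono piece)
    finally show ?thesis .
  qed
  have "(\<lambda>n. \<integral>\<^sup>+k. ?J (?g n) k \<partial>count_space UNIV) \<longlonglongrightarrow> (\<integral>\<^sup>+(k::nat). 0 \<partial>count_space UNIV)"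
  proof (rule nn_integral_dominated_convergence[where w = "\<lambda>k. T_norm k * ennreal B + T_norm k * ennreal B"])
    have "(\<integral>\<^sup>+k. T_norm k * ennreal B + T_norm k * ennreal B \<partial>count_space UNIV)
        = (\<integral>\<^sup>+k. T_norm k * ennreal B \<partial>count_space UNIV) + (\<integral>\<^sup>+k. T_norm k * ennreal B \<partial>count_space UNIV)"
      by (rule nn_integral_add) auto
    also have "(\<integral>\<^sup>+k. T_norm k * ennreal B \<partial>count_space UNIV) = ennreal M * ennreal B"
      by (simp add: nn_integral_count_space_nat sum_T)
    finally show "(\<integral>\<^sup>+k. T_norm k * ennreal B + T_norm k * ennreal B \<partial>count_space UNIV) < \<infinity>"
      by (simp add: ennreal_mult_less_top)
    show "AE k in count_space UNIV. ?J (?g n) k \<le> T_norm k * ennreal B + T_norm k * ennreal B" for n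
      using dom by (intro AE_I2)
    show "AE k in count_space UNIV. (\<lambda>n. ?J (?g n) k) \<longlonglongrightarrow> 0"
      using J by (intro AE_I2)
  qed auto
  then have lim: "(\<lambda>n. \<Sum>k. ?J (?g n) k) \<longlonglongrightarrow> 0"
    by (simp add: nn_integral_count_space_nat)
  have le: "weighted_norm T (?g n) t \<le> (\<Sum>k. ?J (?g n) k)" for n
    by (rule weighted_norm_le_suminf[OF strongly_measurable_f_shift])
  show ?thesis
    by (rule tendsto_sandwich[OF _ _ tendsto_const lim]) (use le in auto)
qed

definition mild_map :: "(real \<Rightarrow> 'a) \<Rightarrow> real \<Rightarrow> 'a"
  where "mild_map u t = strong_integral (lebesgue_on {0<..})
    (\<lambda>r. blinfun_apply (T r) (f (t - r) (u (t - r))))"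

lemma strongly_measurable_f_comp:
  assumes "almost_periodic u"
  shows "strongly_measurable lebesgue (\<lambda>s. f s (u s))"
  by (rule strongly_measurable_caratheodory[OF strongly_measurable_f
    lipschitz_isCont[OF lipschitz] almost_periodic_isCont[OF assms]])

lemma weighted_norm_f_comp_finite:
  assumes u: "almost_periodic u"
  shows "weighted_norm T (\<lambda>s. f s (u s)) t < \<infinity>"
proof -
  obtain B where B: "B \<ge> 0" "\<And>t. norm (u t) \<le> B" using almost_periodic_bounded[OF u] by metis
  obtain B' where B': "\<And>a x. Stepanov_norm p (\<lambda>s. f (a + s) x) \<le> ennreal B'"
    using f_bound by metis
  have "norm (f s (u s)) \<le> L * B + (\<Sum>x\<in>{0}. norm (f s x))" for s
  proof -
    have "norm (f s (u s) - f s 0) \<le> L * norm (u s - 0)" by (rule lipschitz)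
    also have "\<dots> \<le> L * B" using B L by (simp add: mult_left_mono)
    finally show ?thesis using norm_triangle_sub[of "f s (u s)" "f s 0"] by simp
  qed
  then have "weighted_norm T (\<lambda>s. f s (u s)) t
      \<le> ennreal (M * (L * B)) + (\<Sum>x\<in>{0}. weighted_norm T (\<lambda>s. f s x) t)"
    using L B by (intro weighted_norm_sum_le strongly_measurable_f) auto
  also have "(\<Sum>x\<in>{0}. weighted_norm T (\<lambda>s. f s x) t) = weighted_norm T (\<lambda>s. f s 0) t"
    by simp
  also have "ennreal (M * (L * B)) + weighted_norm T (\<lambda>s. f s 0) t
      \<le> ennreal (M * (L * B)) + ennreal M * ennreal B'"
    by (intro add_left_mono weighted_norm_le[OF strongly_measurable_f B'])
  also have "\<dots> < \<infinity>" by (simp add: ennreal_mult_less_top)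
  finally show ?thesis .
qed

lemma has_strong_integral_mild_map:
  assumes u: "almost_periodic u"
  shows "has_strong_integral (lebesgue_on {0<..})
    (\<lambda>r. blinfun_apply (T r) (f (t - r) (u (t - r)))) (mild_map u t)"
  unfolding mild_map_def
proof (rule has_strong_integral_strong_integral)
  show "complete_measure (lebesgue_on {0::real<..})" by (rule complete_measure_lebesgue_on) simp
  have "strongly_measurable (lebesgue_on {0<..}) (\<lambda>r. f (t - r) (u (t - r)))"
    by (intro strongly_measurable_restrict_space
      strongly_measurable_reflect[OF strongly_measurable_f_comp[OF u]]) simp
  then show "strongly_measurable (lebesgue_on {0<..}) (\<lambda>r. blinfun_apply (T r) (f (t - r) (u (t - r))))"
    by (intro strongly_measurable_compose2[where p = blinfun_apply] strongly_measurable_T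
      bounded_bilinear.tendsto[OF bounded_bilinear_blinfun_apply]) auto
  have "(\<integral>\<^sup>+r. norm (blinfun_apply (T r) (f (t - r) (u (t - r)))) \<partial>lebesgue_on {0<..})
      \<le> weighted_norm T (\<lambda>s. f s (u s)) t"
    unfolding weighted_norm_def by (intro nn_integral_mono ennreal_leI norm_blinfun)
  then show "(\<integral>\<^sup>+r. norm (blinfun_apply (T r) (f (t - r) (u (t - r)))) \<partial>lebesgue_on {0<..}) < \<infinity>"
    using weighted_norm_f_comp_finite[OF u] by (rule order.strict_trans1)
qed

lemma mild_solution_iff:
  assumes u: "almost_periodic u"
  shows "mild_solution T f u \<longleftrightarrow> (\<forall>t. mild_map u t = u t)"
proof -
  have has: "has_strong_integral (lebesgue_on {..<t})
      (\<lambda>s. blinfun_apply (T (t - s)) (f s (u s))) (mild_map u t)" for t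
    using has_strong_integral_reflect[OF has_strong_integral_mild_map[OF u, of t], of t] by simp
  have cm: "complete_measure (lebesgue_on {..<t::real})" for t
    by (rule complete_measure_lebesgue_on) simp
  have "has_strong_integral (lebesgue_on {..<t}) (\<lambda>s. blinfun_apply (T (t - s)) (f s (u s))) (u t)
      \<longleftrightarrow> mild_map u t = u t" for t
  proof
    assume "has_strong_integral (lebesgue_on {..<t}) (\<lambda>s. blinfun_apply (T (t - s)) (f s (u s))) (u t)"
    then show "mild_map u t = u t" by (rule has_strong_integral_unique[OF cm has])
  next
    assume eq: "mild_map u t = u t"
    show "has_strong_integral (lebesgue_on {..<t}) (\<lambda>s. blinfun_apply (T (t - s)) (f s (u s))) (u t)"
      using has[of t] unfolding eq .
  qed
  moreover have "continuous_on UNIV u" using u by (simp only: almost_periodic_def)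
  ultimately show ?thesis by (simp add: mild_solution_def)
qed

lemma mild_map_dist:
  assumes u: "almost_periodic u" "almost_periodic v"
  shows "ennreal (norm (mild_map u t - mild_map v (t + h)))
    \<le> weighted_norm T (\<lambda>s. f s (u s) - f (s + h) (v (s + h))) t"
proof -
  have "complete_measure (lebesgue_on {0::real<..})" by (rule complete_measure_lebesgue_on) simp
  from has_strong_integral_dist[OF this has_strong_integral_mild_map[OF u(1), of t]
      has_strong_integral_mild_map[OF u(2), of "t + h"]]
  have "ennreal (norm (mild_map u t - mild_map v (t + h)))
      \<le> (\<integral>\<^sup>+r. norm (blinfun_apply (T r) (f (t - r) (u (t - r)))
        - blinfun_apply (T r) (f (t + h - r) (v (t + h - r)))) \<partial>lebesgue_on {0<..})" .
  also have "\<dots> \<le> weighted_norm T (\<lambda>s. f s (u s) - f (s + h) (v (s + h))) t"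
    unfolding weighted_norm_def
  proof (intro nn_integral_mono ennreal_leI)
    fix r
    have "blinfun_apply (T r) (f (t - r) (u (t - r))) - blinfun_apply (T r) (f (t + h - r) (v (t + h - r)))
        = blinfun_apply (T r) (f (t - r) (u (t - r)) - f (t - r + h) (v (t - r + h)))"
      by (simp add: blinfun.diff_right add_diff_eq diff_add_eq)
    then show "norm (blinfun_apply (T r) (f (t - r) (u (t - r)))
        - blinfun_apply (T r) (f (t + h - r) (v (t + h - r))))
        \<le> norm (T r) * norm (f (t - r) (u (t - r)) - f (t - r + h) (v (t - r + h)))"
      by (simp add: norm_blinfun)
  qed
  finally show ?thesis .
qed

lemma mild_map_lipschitz:
  assumes u: "almost_periodic u" "almost_periodic v" and D: "\<And>s. norm (u s - v s) \<le> D"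
  shows "norm (mild_map u t - mild_map v t) \<le> M * L * D"
proof -
  have D0: "D \<ge> 0" using D[of 0] norm_ge_zero order_trans by blast
  have le: "norm (f s (u s) - f s (v s)) \<le> L * D" for s
    using order_trans[OF lipschitz mult_left_mono[OF D]] L by simp
  have "ennreal (norm (mild_map u t - mild_map v t)) \<le> weighted_norm T (\<lambda>s. f s (u s) - f s (v s)) t"
    using mild_map_dist[OF u, of t 0] by simp
  also have "\<dots> \<le> ennreal (M * (L * D)) + (\<Sum>i\<in>({}::nat set). weighted_norm T (\<lambda>_. 0 :: real) t)"
    using D0 L le by (intro weighted_norm_sum_le) auto
  finally show ?thesis using M L D0 by (simp add: mult.assoc)
qed

text \<open>Replacing \<open>u s\<close> by a point of the finite net \<open>K\<close> reduces the dependence on the second argument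
  of \<open>f\<close> to finitely many functions of time.\<close>

lemma mild_map_shift:
  assumes u: "almost_periodic u" and K: "finite K" "\<And>s. \<exists>x\<in>K. norm (u s - x) \<le> \<eta>"
    and h: "\<And>s. norm (u (s + h) - u s) \<le> \<eta>"
  shows "ennreal (norm (mild_map u (t + h) - mild_map u t))
    \<le> ennreal (M * (3 * L * \<eta>)) + (\<Sum>x\<in>K. weighted_norm T (\<lambda>s. f (s + h) x - f s x) t)"
proof -
  have \<eta>: "\<eta> \<ge> 0" using h[of 0] norm_ge_zero order_trans by blast
  have "norm (f s (u s) - f (s + h) (u (s + h)))
      \<le> 3 * L * \<eta> + (\<Sum>x\<in>K. norm (f (s + h) x - f s x))" for s
  proof -
    obtain x where x: "x \<in> K" "norm (u s - x) \<le> \<eta>" using K(2) by blast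
    have L_le: "norm (f r y - f r z) \<le> L * \<eta>" if "norm (y - z) \<le> \<eta>" for r y z
      using order_trans[OF lipschitz mult_left_mono[OF that]] L by simp
    have "norm (f s (u s) - f (s + h) (u (s + h)))
        = norm ((f s (u s) - f s x) + (f s x - f (s + h) x)
          + (f (s + h) x - f (s + h) (u s)) + (f (s + h) (u s) - f (s + h) (u (s + h))))"
      by simp
    also have "\<dots> \<le> norm (f s (u s) - f s x) + norm (f s x - f (s + h) x)
        + norm (f (s + h) x - f (s + h) (u s)) + norm (f (s + h) (u s) - f (s + h) (u (s + h)))"
      by (intro norm_triangle_mono norm_triangle_ineq order_refl)
    also have "\<dots> \<le> L * \<eta> + norm (f (s + h) x - f s x) + L * \<eta> + L * \<eta>"
      using x(2) h[of s] by (intro add_mono L_le) (simp_all add: norm_minus_commute)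
    also have "norm (f (s + h) x - f s x) \<le> (\<Sum>x\<in>K. norm (f (s + h) x - f s x))"
      using x(1) K(1) by (intro member_le_sum) auto
    finally show ?thesis by simp
  qed
  then have "weighted_norm T (\<lambda>s. f s (u s) - f (s + h) (u (s + h))) t
      \<le> ennreal (M * (3 * L * \<eta>)) + (\<Sum>x\<in>K. weighted_norm T (\<lambda>s. f (s + h) x - f s x) t)"
    using L \<eta> by (intro weighted_norm_sum_le K strongly_measurable_f_shift) auto
  with mild_map_dist[OF u u, of t h] show ?thesis
    by (auto simp: norm_minus_commute intro: order_trans)
qed

lemma net_radius:
  assumes "\<epsilon> > 0"
  obtains \<eta> where "\<eta> > 0" "M * (3 * L * \<eta>) \<le> \<epsilon>"
proof
  show "\<epsilon> / (3 * L * (M + 1)) > 0" using assms L M by simp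
  have "3 * L * (\<epsilon> / (3 * L * (M + 1))) = \<epsilon> / (M + 1)" using L by simp
  then have "M * (3 * L * (\<epsilon> / (3 * L * (M + 1)))) = M / (M + 1) * \<epsilon>"
    by (simp only: times_divide_eq_right times_divide_eq_left)
  also have "\<dots> \<le> 1 * \<epsilon>" using M assms by (intro mult_right_mono) auto
  finally show "M * (3 * L * (\<epsilon> / (3 * L * (M + 1)))) \<le> \<epsilon>" by simp
qed

lemma isCont_mild_map:
  assumes u: "almost_periodic u"
  shows "isCont (mild_map u) t"
proof (rule continuous_at_sequentiallyI)
  fix Y :: "nat \<Rightarrow> real" assume "Y \<longlonglongrightarrow> t"
  then have "(\<lambda>n. Y n - t) \<longlonglongrightarrow> t - t" by (intro tendsto_intros)
  moreover define X where "X n = Y n - t" for n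
  ultimately have X: "X \<longlonglongrightarrow> 0" by (simp add: X_def[abs_def])
  show "(\<lambda>n. mild_map u (Y n)) \<longlonglongrightarrow> mild_map u t"
  proof (rule tendstoI)
    fix \<epsilon> :: real assume \<epsilon>: "\<epsilon> > 0"
    obtain \<eta> where \<eta>: "\<eta> > 0" "M * (3 * L * \<eta>) \<le> \<epsilon> / 2"
      using net_radius[of "\<epsilon> / 2"] \<epsilon> by auto
    obtain K where K: "finite K" "\<And>s. \<exists>x\<in>K. norm (u s - x) \<le> \<eta>"
      using almost_periodic_finite_net[OF u \<eta>(1)] by metis
    obtain \<delta> where \<delta>: "\<delta> > 0" "\<And>t h. \<bar>h\<bar> \<le> \<delta> \<Longrightarrow> norm (u (t + h) - u t) \<le> \<eta>"
      using almost_periodic_uniformly_continuous[OF u \<eta>(1)] by metis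
    have "(\<lambda>n. \<Sum>x\<in>K. weighted_norm T (\<lambda>s. f (s + X n) x - f s x) t) \<longlonglongrightarrow> (\<Sum>x\<in>K. 0)"
      by (intro tendsto_sum weighted_norm_shift_tendsto X)
    then have "\<forall>\<^sub>F n in sequentially. (\<Sum>x\<in>K. weighted_norm T (\<lambda>s. f (s + X n) x - f s x) t) < ennreal (\<epsilon> / 2)"
      using \<epsilon> by (intro order_tendstoD(2)) auto
    moreover have "\<forall>\<^sub>F n in sequentially. dist (X n) 0 < \<delta>"
      using X \<delta>(1) by (rule tendstoD)
    ultimately show "\<forall>\<^sub>F n in sequentially. dist (mild_map u (Y n)) (mild_map u t) < \<epsilon>"
    proof eventually_elim
      case (elim n)
      have "ennreal (norm (mild_map u (t + X n) - mild_map u t))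
          \<le> ennreal (M * (3 * L * \<eta>)) + (\<Sum>x\<in>K. weighted_norm T (\<lambda>s. f (s + X n) x - f s x) t)"
        using elim(2) by (intro mild_map_shift u K \<delta>(2)) simp
      also have "\<dots> \<le> ennreal (\<epsilon> / 2) + (\<Sum>x\<in>K. weighted_norm T (\<lambda>s. f (s + X n) x - f s x) t)"
        using \<eta>(2) by (intro add_right_mono ennreal_leI)
      also have "\<dots> < ennreal (\<epsilon> / 2) + ennreal (\<epsilon> / 2)"
        using elim(1) by (simp add: ennreal_add_left_cancel_less)
      also have "\<dots> = ennreal \<epsilon>" using \<epsilon> by (simp flip: ennreal_plus)
      finally show ?case by (simp add: X_def dist_norm ennreal_less_iff)
    qed
  qed
qed

lemma almost_periodic_mild_map:
  assumes u: "almost_periodic u"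
  shows "almost_periodic (mild_map u)"
  unfolding almost_periodic_relatively_dense
proof (intro conjI allI impI)
  show "continuous_on UNIV (mild_map u)"
    using isCont_mild_map[OF u] by (simp add: continuous_on_eq_continuous_at)
  fix \<epsilon> :: real assume \<epsilon>: "\<epsilon> > 0"
  obtain \<eta> where \<eta>: "\<eta> > 0" "M * (3 * L * \<eta>) \<le> \<epsilon> / 2"
    using net_radius[of "\<epsilon> / 2"] \<epsilon> by auto
  obtain K where K: "finite K" "\<And>s. \<exists>x\<in>K. norm (u s - x) \<le> \<eta>"
    using almost_periodic_finite_net[OF u \<eta>(1)] by metis
  define e where "e = \<epsilon> / (4 * (M + 1) * (real (card K) + 1))"
  have e: "e > 0" using \<epsilon> M by (simp add: e_def)
  have e_le: "real (card K) * (M * e + M * e) \<le> \<epsilon> / 2"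
  proof -
    have "real (card K) * (M * e + M * e) \<le> (real (card K) + 1) * ((M + 1) * e + (M + 1) * e)"
      using M e by (intro mult_mono add_mono) auto
    also have "\<dots> = (\<epsilon> / 2) * (((real (card K) + 1) * (M + 1)) / ((real (card K) + 1) * (M + 1)))"
      by (simp add: e_def field_simps)
    also have "\<dots> = \<epsilon> / 2" using M by simp
    finally show ?thesis .
  qed
  define A where "A = {\<tau>. \<forall>t. \<forall>x\<in>K. Stepanov_norm p (\<lambda>s. f (t + \<tau> + s) x - f (t + s) x) \<le> ennreal e}"
  define B where "B = {\<tau>. \<forall>t. norm (u (t + \<tau>) - u t) \<le> \<eta> / 3}"
  have "relatively_dense A"
  proof -
    have "\<exists>l>0. \<forall>a. \<exists>\<tau>\<in>{a..a + l}. \<forall>t. \<forall>x\<in>K.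
        Stepanov_norm p (\<lambda>s. f_hat f (t + \<tau>, x) s - f_hat f (t, x) s) \<le> ennreal e"
    proof -
      have "\<forall>\<epsilon>>0. \<forall>K. compact K \<longrightarrow> (\<exists>l>0. \<forall>a. \<exists>\<tau>\<in>{a..a + l}. \<forall>t. \<forall>x\<in>K.
          Stepanov_norm p (\<lambda>s. f_hat f (t + \<tau>, x) s - f_hat f (t, x) s) \<le> ennreal \<epsilon>)"
        using f unfolding APS_def by (elim CollectE conjE)
      from this[rule_format, OF e finite_imp_compact[OF K(1)]] show ?thesis .
    qed
    then show ?thesis by (simp add: relatively_dense_def A_def f_hat_def)
  qed
  moreover have "\<eta> / 3 > 0" using \<eta>(1) by simp
  from conjunct2[OF u[unfolded almost_periodic_relatively_dense], rule_format, OF this]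
  have "relatively_dense B" unfolding B_def .
  moreover obtain \<delta> where \<delta>: "\<delta> > 0" "\<And>t h. \<bar>h\<bar> \<le> \<delta> \<Longrightarrow> norm (u (t + h) - u t) \<le> \<eta> / 3"
    using almost_periodic_uniformly_continuous[OF u, of "\<eta> / 3"] \<eta>(1) by auto
  ultimately have dense: "relatively_dense {a - a' | a a'. a \<in> A \<and> a' \<in> A \<and>
      (\<exists>b\<in>B. \<exists>b'\<in>B. \<bar>(a - a') - (b - b')\<bar> \<le> \<delta>)}"
    by (intro relatively_dense_common_differences)
  have tri: "norm (x + y - z) \<le> norm x + norm y + norm z" for x y z :: 'a
    using norm_triangle_ineq4[of "x + y" z] norm_triangle_ineq[of x y] by linarith
  have B: "norm (u (t + \<tau>) - u t) \<le> \<eta> / 3" if "\<tau> \<in> B" for t \<tau>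
    using that unfolding B_def by blast
  from dense show "relatively_dense {\<tau>. \<forall>t. norm (mild_map u (t + \<tau>) - mild_map u t) \<le> \<epsilon>}"
  proof (rule relatively_dense_mono, safe)
    fix a a' b b' t
    assume a: "a \<in> A" "a' \<in> A" and b: "b \<in> B" "b' \<in> B" and ab: "\<bar>(a - a') - (b - b')\<bar> \<le> \<delta>"
    define h where "h = a - a'"
    have shift: "norm (u (s + h) - u s) \<le> \<eta>" for s
    proof -
      have 1: "norm (u (s + h) - u (s + (b - b'))) \<le> \<eta> / 3"
        using \<delta>(2)[OF ab, of "s + (b - b')"] by (simp add: h_def)
      have 2: "norm (u (s + (b - b')) - u (s - b')) \<le> \<eta> / 3"
        using B[OF b(1), of "s - b'"] by (simp add: algebra_simps)
      have 3: "norm (u s - u (s - b')) \<le> \<eta> / 3"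
        using B[OF b(2), of "s - b'"] by simp
      have "norm (u (s + h) - u s) = norm ((u (s + h) - u (s + (b - b')))
          + (u (s + (b - b')) - u (s - b')) - (u s - u (s - b')))"
        by simp
      also have "\<dots> \<le> norm (u (s + h) - u (s + (b - b')))
          + norm (u (s + (b - b')) - u (s - b')) + norm (u s - u (s - b'))"
        by (rule tri)
      finally show ?thesis using 1 2 3 by simp
    qed
    have wn: "weighted_norm T (\<lambda>s. f (s + h) x - f s x) t \<le> ennreal (M * e + M * e)" if x: "x \<in> K" for x
    proof -
      have le: "weighted_norm T (\<lambda>s. f (s + \<tau>) x - f s x) r \<le> ennreal (M * e)" if "\<tau> \<in> A" for \<tau> r
      proof -
        have "Stepanov_norm p (\<lambda>s. f (c + s + \<tau>) x - f (c + s) x) \<le> ennreal e" for c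
        proof -
          have "Stepanov_norm p (\<lambda>s. f (c + \<tau> + s) x - f (c + s) x) \<le> ennreal e"
            using that x by (simp add: A_def)
          then show ?thesis by (simp add: add_ac)
        qed
        from weighted_norm_le[OF strongly_measurable_f_shift this, of r] show ?thesis
          using M e by (simp add: ennreal_mult)
      qed
      have eq: "weighted_norm T (\<lambda>s. g (s - a')) t = weighted_norm T g (t - a')" for g :: "real \<Rightarrow> 'a"
        by (simp add: weighted_norm_def algebra_simps)
      have sm: "strongly_measurable lebesgue (\<lambda>s. f (s - a' + \<tau>) x - f (s - a') x)" for \<tau>
        using strongly_measurable_shift[OF strongly_measurable_f_shift[of \<tau> x], of "- a'"] by simp
      have "weighted_norm T (\<lambda>s. f (s + h) x - f s x) t
          \<le> weighted_norm T (\<lambda>s. f (s - a' + a) x - f (s - a') x) t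
            + weighted_norm T (\<lambda>s. f (s - a' + a') x - f (s - a') x) t"
      proof (rule weighted_norm_triangle[OF sm sm])
        show "norm (f (s + h) x - f s x)
            \<le> norm (f (s - a' + a) x - f (s - a') x) + norm (f (s - a' + a') x - f (s - a') x)" for s
          using norm_triangle_ineq4[of "f (s - a' + a) x - f (s - a') x" "f s x - f (s - a') x"]
          by (simp add: h_def algebra_simps)
      qed
      also have "\<dots> \<le> ennreal (M * e) + ennreal (M * e)"
        using le[OF a(1), of "t - a'"] le[OF a(2), of "t - a'"]
          eq[of "\<lambda>s. f (s + a) x - f s x"] eq[of "\<lambda>s. f (s + a') x - f s x"]
        by (intro add_mono) simp_all
      also have "\<dots> = ennreal (M * e + M * e)" using M e by (intro ennreal_plus[symmetric]) auto
      finally show ?thesis .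
    qed
    have "ennreal (norm (mild_map u (t + h) - mild_map u t))
        \<le> ennreal (M * (3 * L * \<eta>)) + (\<Sum>x\<in>K. weighted_norm T (\<lambda>s. f (s + h) x - f s x) t)"
      by (rule mild_map_shift[OF u K shift])
    also have "\<dots> \<le> ennreal (\<epsilon> / 2) + (\<Sum>x\<in>K. ennreal (M * e + M * e))"
      using \<eta>(2) wn by (intro add_mono ennreal_leI sum_mono)
    also have "(\<Sum>x\<in>K. ennreal (M * e + M * e)) = ennreal (real (card K) * (M * e + M * e))"
      using M e by (subst sum_ennreal) auto
    also have "\<dots> \<le> ennreal (\<epsilon> / 2)" by (rule ennreal_leI[OF e_le])
    also have "ennreal (\<epsilon> / 2) + ennreal (\<epsilon> / 2) = ennreal \<epsilon>"
      using \<epsilon> by (simp flip: ennreal_plus)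
    finally show "norm (mild_map u (t + (a - a')) - mild_map u t) \<le> \<epsilon>"
      using \<epsilon> by (simp add: h_def add_left_mono)
  qed
qed

theorem ex1_almost_periodic_mild_solution:
  assumes contraction: "M * L < 1"
  shows "\<exists>!u. almost_periodic u \<and> mild_solution T f u"
proof -
  define S where "S = {w :: real \<Rightarrow>\<^sub>C 'a. almost_periodic (apply_bcontfun w)}"
  have bc: "u \<in> bcontfun" if "almost_periodic u" for u :: "real \<Rightarrow> 'a"
    using almost_periodic_bounded[OF that] that bcontfun_normI
    by (metis almost_periodic_def)
  define \<Lambda> where "\<Lambda> w = Bcontfun (mild_map (apply_bcontfun w))" for w
  have \<Lambda>: "apply_bcontfun (\<Lambda> w) = mild_map (apply_bcontfun w)" if "w \<in> S" for w
    using that bc[OF almost_periodic_mild_map] by (simp add: \<Lambda>_def S_def Bcontfun_inverse)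
  have "closed S"
    unfolding closed_sequential_limits
  proof (intro allI impI, elim conjE)
    fix w v assume w: "\<forall>n. w n \<in> S" and lim: "w \<longlonglongrightarrow> v"
    have "almost_periodic (apply_bcontfun v)"
    proof (rule almost_periodic_uniform_limit)
      fix \<epsilon> :: real assume "\<epsilon> > 0"
      then obtain n where n: "dist (w n) v < \<epsilon>"
        using metric_LIMSEQ_D[OF lim] by blast
      have "norm (apply_bcontfun v t - apply_bcontfun (w n) t) \<le> \<epsilon>" for t
        using dist_bounded[of v t "w n"] n by (simp add: dist_norm norm_minus_commute dist_commute)
      then show "\<exists>v'. almost_periodic v' \<and> (\<forall>t. norm (apply_bcontfun v t - v' t) \<le> \<epsilon>)"
        using w by (intro exI[of _ "apply_bcontfun (w n)"]) (auto simp: S_def)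
    qed simp
    then show "v \<in> S" by (simp add: S_def)
  qed
  moreover have "(0 :: real \<Rightarrow>\<^sub>C 'a) \<in> S"
    using almost_periodic_zero by (simp add: S_def zero_bcontfun.rep_eq)
  ultimately have "\<exists>!w\<in>S. \<Lambda> w = w"
  proof (intro Banach_fix[where c = "M * L"])
    show "\<Lambda> ` S \<subseteq> S"
      using \<Lambda> almost_periodic_mild_map by (auto simp: S_def)
    show "dist (\<Lambda> w) (\<Lambda> v) \<le> M * L * dist w v" if "w \<in> S" "v \<in> S" for w v
    proof (rule dist_bound)
      fix t
      have "norm (mild_map (apply_bcontfun w) t - mild_map (apply_bcontfun v) t) \<le> M * L * dist w v"
        using that dist_bounded[of w _ v] by (intro mild_map_lipschitz) (auto simp: S_def dist_norm)
      then show "dist (apply_bcontfun (\<Lambda> w) t) (apply_bcontfun (\<Lambda> v) t) \<le> M * L * dist w v"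
        using that by (simp add: \<Lambda> dist_norm)
    qed
  qed (use M L contraction in \<open>auto simp: complete_eq_closed\<close>)
  then obtain w where w: "w \<in> S" "\<Lambda> w = w" and uniq: "\<And>v. v \<in> S \<Longrightarrow> \<Lambda> v = v \<Longrightarrow> v = w" by blast
  have fixpt_iff: "mild_solution T f (apply_bcontfun v) \<longleftrightarrow> \<Lambda> v = v" if "v \<in> S" for v
  proof -
    have "mild_solution T f (apply_bcontfun v) \<longleftrightarrow> apply_bcontfun (\<Lambda> v) = apply_bcontfun v"
      using that by (simp add: \<Lambda> mild_solution_iff S_def fun_eq_iff)
    then show ?thesis by (simp add: apply_bcontfun_inject)
  qed
  show ?thesis
  proof
    show "almost_periodic (apply_bcontfun w) \<and> mild_solution T f (apply_bcontfun w)"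
      using w fixpt_iff by (simp add: S_def)
    fix u assume u: "almost_periodic u \<and> mild_solution T f u"
    then have eq: "apply_bcontfun (Bcontfun u) = u" using bc by (simp add: Bcontfun_inverse)
    then have "Bcontfun u \<in> S" using u by (simp add: S_def)
    moreover from this have "\<Lambda> (Bcontfun u) = Bcontfun u" using u eq fixpt_iff by metis
    ultimately have "Bcontfun u = w" by (rule uniq)
    then show "u = apply_bcontfun w" using eq by simp
  qed
qed

end

theorem theorem2p9:
  fixes \<A> :: "'a :: complex_banach \<Rightarrow> 'a set"
    and T :: "real \<Rightarrow> 'a \<Rightarrow>\<^sub>L 'a"
    and f :: "real \<Rightarrow> 'a \<Rightarrow> 'a"
    and c M\<^sub>0 \<beta> p L :: real
    and q' :: ereal
    and M :: ennreal
  assumes "MLO \<A>"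
    and "condition_P \<A> c M\<^sub>0 \<beta>"
    and "T = degenerate_semigroup \<A> c"
    and "p \<ge> 1"
    and "f \<in> APS p"
    and "L > 0"
    and "\<And>t x y. norm (f t x - f t y) \<le> L * norm (x - y)"
    and "p = 1 \<Longrightarrow> \<beta> = 1"
    and "p > 1 \<Longrightarrow> ereal (p / (p - 1)) < (if \<beta> = 1 then \<infinity> else ereal (1 / (1 - \<beta>)))"
    and "q' = (if p = 1 then \<infinity> else ereal (p / (p - 1)))"
    and "M = (\<Sum>k. Lq_norm q' (lebesgue_on {real k..real k + 1}) (\<lambda>t. norm (T t)))"
    and "M < \<infinity>"
    and "M * ennreal L < 1"
  shows "\<exists>!u. almost_periodic u \<and> mild_solution T f u"
proof -
  have fin: "ennreal (enn2real M) = M" using assms(12) by simp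
  interpret mild_problem T p "enn2real M" q' f L
  proof
    show "isCont T t" if "0 < t" for t
      using isCont_degenerate_semigroup[OF assms(1,2) that] by (simp add: assms(3))
    show "(\<Sum>k. Lq_norm q' (lebesgue_on {real k..real k + 1}) (\<lambda>t. norm (T t))) = ennreal (enn2real M)"
      using fin assms(11) by simp
  qed (use assms in auto)
  have "ennreal (enn2real M * L) = ennreal (enn2real M) * ennreal L"
    using assms(6) by (intro ennreal_mult) auto
  also have "\<dots> = M * ennreal L" by (simp only: fin)
  finally have "ennreal (enn2real M * L) < ennreal 1" using assms(13) by simp
  then have "enn2real M * L < 1" by (subst (asm) ennreal_less_iff) (use assms(6) in auto)
  then show ?thesis by (rule ex1_almost_periodic_mild_solution)
qed

end
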